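(* Let $f\in\mathrm{H}(\mathbb{D})$. Then for each $j\ge 0$, the function $f_j(z;z_{j-1},\dots,z_0)$ is complex analytic in $z\in\mathbb{D}$ and real analytic in $z_0,\dots,z_{j-1}\in\mathbb{D}$.
   Context: $\mathbb{D}=\{z\in\mathbb{C}:|z|<1\}$, and $\mathrm{H}(\mathbb{D})$ is the set of holomorphic functions $f$ on $\mathbb{D}$ with $|f|\le 1$. For $z,w\in\mathbb{D}$ put $[z,w]=\dfrac{z-w}{1-\overline{w}z}$, and put $[z,z]=0$ for $z\in\partial\mathbb{D}$. For $f\in\mathrm{H}(\mathbb{D})$ and $z_0\in\mathbb{D}$ define $\Delta_{z_0}f\in\mathrm{H}(\mathbb{D})$ by $\Delta_{z_0}f(z)=\dfrac{[f(z),f(z_0)]}{[z,z_0]}$ for $z\neq z_0$ and $\Delta_{z_0}f(z_0)=\dfrac{(1-|z_0|^2)f'(z_0)}{1-|f(z_0)|^2}$ (if $f$ is a unimodular constant, $\Delta_{z_0}f\equiv 0$). It is known from the Schwarz–Pick lemma that $\Delta_{z_0}$ maps $\mathrm{H}(\mathbb{D})$ into itself. For points $z_0,z_1,\dots\in\mathbb{D}$ (not necessarily distinct) define $f_j(z;z_{j-1},\dots,z_0)=(\Delta_{z_{j-1}}\circ\cdots\circ\Delta_{z_0})f(z)$, with $f_0(z)=f(z)$ for $j=0$. *)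

theory Defs
  imports "HOL-Complex_Analysis.Complex_Analysis"
begin

abbreviation unit_disc :: "complex set" where
  "unit_disc \<equiv> ball 0 1"

definition H_disc :: "(complex \<Rightarrow> complex) set" where
  "H_disc = {f. f holomorphic_on unit_disc \<and> (\<forall>z\<in>unit_disc. norm (f z) \<le> 1)}"

text \<open>The convention \<open>[z,z] = 0\<close> for \<open>|z| = 1\<close> holds because \<open>0 / 0 = 0\<close>.\<close>

definition hyp_bracket :: "complex \<Rightarrow> complex \<Rightarrow> complex" where
  "hyp_bracket z w = (z - w) / (1 - cnj w * z)"

text \<open>If \<open>f\<close> is a unimodular constant \<open>u\<close> on the disc, then \<open>hyp_diff z0 f\<close> vanishes on the disc:
  \<open>deriv f z0 = 0\<close> and \<open>hyp_bracket u u = 0\<close>.\<close>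

definition hyp_diff :: "complex \<Rightarrow> (complex \<Rightarrow> complex) \<Rightarrow> complex \<Rightarrow> complex" where
  "hyp_diff z0 f z =
     (if z = z0
      then complex_of_real (1 - (norm z0)\<^sup>2) * deriv f z0 / complex_of_real (1 - (norm (f z0))\<^sup>2)
      else hyp_bracket (f z) (f z0) / hyp_bracket z z0)"

text \<open>\<open>hyp_iter f zs j z\<close> is \<open>f\<^sub>j(z; z\<^sub>j\<^sub>-\<^sub>1, \<dots>, z\<^sub>0)\<close> with \<open>z\<^sub>i = zs i\<close>;
  it depends only on the entries \<open>zs i\<close> with \<open>i < j\<close>.\<close>

primrec hyp_iter :: "(complex \<Rightarrow> complex) \<Rightarrow> (nat \<Rightarrow> complex) \<Rightarrow> nat \<Rightarrow> complex \<Rightarrow> complex" where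
  "hyp_iter f zs 0 = f"
| "hyp_iter f zs (Suc j) = hyp_diff (zs j) (hyp_iter f zs j)"

text \<open>Points of \<open>\<complex>\<^sup>n\<close> are represented by functions on \<open>nat\<close> whose entries from \<open>n\<close> onwards are
  irrelevant, so that \<open>n\<close> may be any natural number, including \<open>0\<close>.\<close>

definition polydisc :: "nat \<Rightarrow> (nat \<Rightarrow> complex) set" where
  "polydisc n = {w. \<forall>i<n. w i \<in> unit_disc}"

definition multi_indices :: "nat \<Rightarrow> (nat \<Rightarrow> nat) set" where
  "multi_indices n = {\<alpha>. \<forall>i\<ge>n. \<alpha> i = 0}"

text \<open>Joint real analyticity in \<open>n\<close> complex variables, i.e. in the \<open>2 * n\<close> real variables
  \<open>Re (w i)\<close> and \<open>Im (w i)\<close> for \<open>i < n\<close>: near every point of \<open>U\<close> the function is the sum of an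
  (unconditionally, hence absolutely) convergent power series in these variables.  The pair
  \<open>(\<alpha>, \<beta>)\<close> is the multi-index of the \<open>2 * n\<close> exponents.\<close>

definition real_analytic_on :: "nat \<Rightarrow> ((nat \<Rightarrow> complex) \<Rightarrow> complex) \<Rightarrow> (nat \<Rightarrow> complex) set \<Rightarrow> bool" where
  "real_analytic_on n F U \<longleftrightarrow>
     (\<forall>a\<in>U. \<exists>r>0. \<exists>c. \<forall>w. (\<forall>i<n. norm (w i - a i) < r) \<longrightarrow>
        ((\<lambda>(\<alpha>, \<beta>). c \<alpha> \<beta> *
            (\<Prod>i<n. complex_of_real (Re (w i - a i) ^ \<alpha> i * Im (w i - a i) ^ \<beta> i)))
          has_sum F w) (multi_indices n \<times> multi_indices n))"

end

theory Submission
  imports Defs "HOL-Computational_Algebra.Fundamental_Theorem_Algebra"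
begin

text \<open>
  Only the dependence on the base points is difficult, since \<open>hyp_diff\<close> contains a difference
  quotient, which becomes a derivative when its two points coincide, and complex conjugates, which
  are not holomorphic. Both difficulties disappear after complexification. Write a base point as
  \<open>x + \<i> y\<close> with \<open>x\<close> and \<open>y\<close> real, and let \<open>x\<close> and \<open>y\<close> move in the complex plane.
  Suppose that near \<open>a\<close> the \<open>j\<close>-th iterate is the restriction to real \<open>x, y\<close> of a bounded function
  \<open>F z w\<close>, holomorphic in \<open>z\<close> and in each of the variables \<open>w\<close>. A conjugate
  is the restriction of a holomorphic function as well:
  of \<open>x - \<i> y\<close> for a base point, and of \<open>cnj (F (cnj t) (cnj w))\<close> for a value of \<open>F\<close>. So the formula

    \<open>hyp_diff u f z = divided_diff f u z * (1 - cnj u * z) / (1 - cnj (f u) * f z)\<close>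

  becomes a holomorphic formula for the next iterate. The divided difference of a holomorphic
  function is holomorphic across the diagonal, jointly with the parameters
  (\<open>sep_holo_divided_diff\<close>); and the denominator stays away from \<open>0\<close> near the real points, provided
  that \<open>norm (f u) < 1\<close> (\<open>hyp_diff_family\<close>). The proviso enters because the quotient degenerates
  to \<open>0\<close> when \<open>f\<close> is a unimodular constant. If an iterate could be a unimodular constant for some base
  points and not for others, analyticity might fail at the transition. This does not happen: the
  \<open>k\<close>-th iterate is a unimodular constant exactly if \<open>f\<close> is a finite Blaschke product of degree
  \<open>k\<close>, for \<open>hyp_diff\<close> lowers the degree of a Blaschke product by one, whatever the base point, and
  conversely \<open>f\<close> is a Blaschke product whenever \<open>hyp_diff u f\<close> is one (\<open>hyp_iter_unimodular_dichotomy\<close>).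
  In the degenerate case all further iterates vanish identically.

  By induction, \<open>hyp_iter_complexification\<close> extends every iterate to complex \<open>x\<close> and \<open>y\<close>. A bounded
  separately holomorphic function of finitely many variables is the sum of an absolutely convergent
  power series (\<open>sep_holo_power_series\<close>), and restricting that series to real \<open>x\<close> and \<open>y\<close> gives
  real analyticity.
\<close>

section \<open>The Schwarz--Pick lemma and hyperbolic difference quotients\<close>

definition divided_diff :: "(complex \<Rightarrow> complex) \<Rightarrow> complex \<Rightarrow> complex \<Rightarrow> complex" where
  "divided_diff f w z = (if z = w then deriv f w else (f z - f w) / (z - w))"

lemma divided_diff_commute: "divided_diff f w z = divided_diff f z w"
  by (simp add: divided_diff_def) (metis minus_diff_eq minus_divide_divide)

lemma divided_diff_holomorphic:
  assumes "f holomorphic_on S" "open S" "w \<in> S"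
  shows "divided_diff f w holomorphic_on S"
  using pole_lemma[OF assms(1), of w] assms
  unfolding divided_diff_def by (simp add: interior_open)

text \<open>The two cases in the definition of \<open>hyp_diff\<close> are absorbed by the divided difference, since
  \<open>1 - cnj w * w = 1 - (norm w)\<^sup>2\<close>. In this form every factor has a holomorphic extension to complexified
  base points.\<close>

lemma hyp_diff_eq:
  "hyp_diff z0 f z = divided_diff f z0 z * (1 - cnj z0 * z) / (1 - cnj (f z0) * f z)"
proof -
  have "complex_of_real (1 - (norm w)\<^sup>2) = 1 - cnj w * w" for w
    by (simp only: of_real_diff of_real_1 complex_norm_square mult.commute)
  then show ?thesis
    unfolding hyp_diff_def divided_diff_def hyp_bracket_def by auto
qed

lemma one_minus_cnj_mult_nonzero:
  assumes "norm a < 1" "norm z \<le> 1"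
  shows "1 - cnj a * z \<noteq> 0"
proof
  assume "1 - cnj a * z = 0"
  then have "norm (cnj a * z) = 1" by simp
  then have "norm a * norm z = 1" by (simp add: norm_mult)
  moreover have "norm a * norm z \<le> norm a" using assms(2) by (simp add: mult_left_le)
  ultimately show False using assms(1) by linarith
qed

lemma H_disc_unimodular_value_imp_const:
  assumes f: "f \<in> H_disc" and "w \<in> unit_disc" "norm (f w) = 1" "z \<in> unit_disc"
  shows "f z = f w"
proof -
  have "f constant_on unit_disc"
    by (rule maximum_modulus_principle[where U = unit_disc and \<xi> = w])
       (use assms in \<open>auto simp: H_disc_def\<close>)
  then show ?thesis using assms unfolding constant_on_def by metis
qed

lemma hyp_diff_of_unimodular_value:
  assumes f: "f \<in> H_disc" and "z0 \<in> unit_disc" "norm (f z0) = 1" "z \<in> unit_disc"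
  shows "hyp_diff z0 f z = 0"
  using H_disc_unimodular_value_imp_const[OF assms] assms(3)
  by (simp add: hyp_diff_def hyp_bracket_def)

text \<open>Off \<open>z0\<close>, the bound \<open>norm (hyp_diff z0 f z) \<le> 1\<close> is the Schwarz--Pick inequality, which is
  the Schwarz lemma for \<open>f\<close> composed with the disc automorphisms that move \<open>z0\<close> and \<open>f z0\<close> to the
  origin. At \<open>z0\<close> it follows by continuity.\<close>

lemma hyp_diff_mem_H_disc:
  assumes f: "f \<in> H_disc" and z0: "z0 \<in> unit_disc"
  shows "hyp_diff z0 f \<in> H_disc"
proof (cases "norm (f z0) = 1")
  case True
  then have eq: "hyp_diff z0 f z = 0" if "z \<in> unit_disc" for z
    using hyp_diff_of_unimodular_value[OF f z0 _ that] by simp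
  moreover have "hyp_diff z0 f holomorphic_on unit_disc"
    using holomorphic_transform[OF holomorphic_on_const[of 0]] eq by metis
  ultimately show ?thesis by (simp add: H_disc_def)
next
  case False
  have fhol: "f holomorphic_on unit_disc" and fle: "\<And>z. z \<in> unit_disc \<Longrightarrow> norm (f z) \<le> 1"
    using f by (auto simp: H_disc_def)
  have flt: "norm (f z) < 1" if "z \<in> unit_disc" for z
    using H_disc_unimodular_value_imp_const[OF f that _ z0] fle[OF that] False by fastforce
  define a where "a = f z0"
  have a: "norm a < 1" using flt z0 by (simp add: a_def)
  have z0': "norm z0 < 1" using z0 by simp
  define g where "g = Moebius_function 0 a \<circ> f \<circ> Moebius_function 0 (- z0)"
  have M: "Moebius_function 0 (-z0) z \<in> unit_disc" if "z \<in> unit_disc" for z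
    using Moebius_function_norm_lt_1[of "-z0" z 0] z0 that by simp
  have "g holomorphic_on unit_disc"
    unfolding g_def
    by (intro holomorphic_on_compose_gen[of _ unit_disc _ unit_disc] Moebius_function_holomorphic
          fhol a) (use z0 M flt in auto)
  moreover have "g 0 = 0"
    by (simp add: g_def Moebius_function_simple a_def)
  moreover have "norm (g z) < 1" if "norm z < 1" for z
    unfolding g_def comp_def
    by (intro Moebius_function_norm_lt_1 a flt M) (use that in auto)
  ultimately have schwarz: "norm (g z) \<le> norm z" if "norm z < 1" for z
    using Schwarz_Lemma(1) that by blast
  \<comment> \<open>The Schwarz lemma for \<open>g\<close> at the image of \<open>z\<close> under the automorphism that sends \<open>z0\<close> to \<open>0\<close>.\<close>
  have pick: "norm (hyp_bracket (f z) a) \<le> norm (hyp_bracket z z0)" if "z \<in> unit_disc" for z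
  proof -
    have "norm (Moebius_function 0 z0 z) < 1"
      by (rule Moebius_function_norm_lt_1) (use z0 that in auto)
    then have "norm (g (Moebius_function 0 z0 z)) \<le> norm (Moebius_function 0 z0 z)"
      by (rule schwarz)
    moreover have "Moebius_function 0 (-z0) (Moebius_function 0 z0 z) = z"
      by (rule Moebius_function_compose) (use z0 that in auto)
    ultimately show ?thesis
      by (simp add: g_def hyp_bracket_def Moebius_function_simple)
  qed
  have hol: "hyp_diff z0 f holomorphic_on unit_disc"
    unfolding hyp_diff_eq
    by (intro holomorphic_intros divided_diff_holomorphic fhol z0)
       (use one_minus_cnj_mult_nonzero[of "f z0"] flt[OF z0] fle in auto)
  have le: "norm (hyp_diff z0 f z) \<le> 1" if "z \<in> unit_disc" "z \<noteq> z0" for z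
    using pick[OF that(1)] that(2) by (simp add: hyp_diff_def norm_divide a_def divide_le_eq_1)
  have "continuous_on unit_disc (hyp_diff z0 f)"
    by (rule holomorphic_on_imp_continuous_on[OF hol])
  then have "isCont (hyp_diff z0 f) z0"
    using z0 continuous_on_eq_continuous_at open_ball by blast
  then have "(\<lambda>z. norm (hyp_diff z0 f z)) \<midarrow>z0\<rightarrow> norm (hyp_diff z0 f z0)"
    unfolding isCont_def by (rule tendsto_norm)
  moreover have "eventually (\<lambda>z. norm (hyp_diff z0 f z) \<le> 1) (at z0)"
    using eventually_at_in_open[of unit_disc z0] z0 
    by (auto elim!: eventually_mono intro: le)
  ultimately have "norm (hyp_diff z0 f z0) \<le> 1"
    by (intro tendsto_upperbound[of _ _ "at z0"]) auto
  with le hol show ?thesis unfolding H_disc_def by blast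
qed

lemma hyp_iter_mem_H_disc:
  assumes "f \<in> H_disc" "\<forall>i<k. zs i \<in> unit_disc"
  shows "hyp_iter f zs k \<in> H_disc"
  using assms(2) by (induction k) (auto intro: assms(1) hyp_diff_mem_H_disc)

section \<open>Unimodular iterates and Blaschke products\<close>

lemma continuous_eq_at_excluded_point:
  fixes g h :: "complex \<Rightarrow> complex"
  assumes "isCont g w" "isCont h w" and "\<forall>\<^sub>F z in at w. g z = h z"
  shows "g w = h w"
proof -
  have "g \<midarrow>w\<rightarrow> g w" "h \<midarrow>w\<rightarrow> h w" using assms(1,2) by (auto simp: isCont_def)
  then have "g \<midarrow>w\<rightarrow> h w" using assms(3) tendsto_cong by force
  with \<open>g \<midarrow>w\<rightarrow> g w\<close> show ?thesis using LIM_unique by blast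
qed

text \<open>The polynomial \<open>q\<close> is the reflection of \<open>p\<close> in the unit circle with respect to degree \<open>k\<close>, that is, its
  coefficients are those of \<open>p\<close>, conjugated and in reverse order from \<open>0\<close> to \<open>k\<close>. The
  functional equation forces both degrees to be at most \<open>k\<close>.\<close>

definition reflected :: "nat \<Rightarrow> complex poly \<Rightarrow> complex poly \<Rightarrow> bool" where
  "reflected k p q \<longleftrightarrow> (\<forall>z. z \<noteq> 0 \<longrightarrow> poly q z = z ^ k * cnj (poly p (1 / cnj z)))"

text \<open>The finite Blaschke products of degree exactly \<open>k\<close>. Common zeros of \<open>p\<close> and \<open>q\<close>
  on the unit circle would lower the degree of the quotient; the condition that \<open>q\<close> has no zero in the closed
  disc excludes them. A unimodular factor does not appear, because it can be split
  evenly between \<open>p\<close> and \<open>q\<close>.\<close>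

definition blaschke :: "nat \<Rightarrow> (complex \<Rightarrow> complex) \<Rightarrow> bool" where
  "blaschke k f \<longleftrightarrow> (\<exists>p q. reflected k p q \<and> (\<forall>z\<in>cball 0 1. poly q z \<noteq> 0) \<and>
     (\<forall>z\<in>unit_disc. f z = poly p z / poly q z))"

lemma reflected_sym:
  assumes "reflected k p q"
  shows "reflected k q p"
  unfolding reflected_def
proof (intro allI impI)
  fix z :: complex assume "z \<noteq> 0"
  then have "poly q (1 / cnj z) = (1 / cnj z) ^ k * cnj (poly p z)"
    using assms by (simp add: reflected_def)
  with \<open>z \<noteq> 0\<close> show "poly p z = z ^ k * cnj (poly q (1 / cnj z))"
    by (simp add: power_one_over)
qed

lemma reflected_norm_eq:
  assumes "reflected k p q" "norm z = 1"
  shows "norm (poly p z) = norm (poly q z)"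
proof -
  have "z * cnj z = 1" using assms(2) by (simp add: complex_norm_square [symmetric])
  moreover have "z \<noteq> 0" using assms(2) by auto
  ultimately have "1 / cnj z = z" by (metis nonzero_mult_div_cancel_right complex_cnj_zero_iff)
  then show ?thesis using assms \<open>z \<noteq> 0\<close> by (simp add: reflected_def norm_mult norm_power)
qed

lemma reflected_norm_le:
  assumes "reflected k p q" and q: "\<forall>z\<in>cball 0 1. poly q z \<noteq> 0" and "z \<in> cball 0 1"
  shows "norm (poly p z) \<le> norm (poly q z)"
proof -
  have "norm (poly p z / poly q z) \<le> 1"
  proof (rule maximum_modulus_frontier[where S = "cball 0 1" and f = "\<lambda>z. poly p z / poly q z"])
    show "(\<lambda>z. poly p z / poly q z) holomorphic_on interior (cball 0 1)"
      using q by (intro holomorphic_intros) auto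
    show "continuous_on (closure (cball 0 1)) (\<lambda>z. poly p z / poly q z)"
      using q by (intro continuous_intros) auto
  qed (use assms reflected_norm_eq in \<open>auto simp: norm_divide\<close>)
  then show ?thesis using assms by (simp add: norm_divide divide_le_eq_1 split: if_splits)
qed

text \<open>For \<open>k = 0\<close> the functional equation gives \<open>q\<close> a finite limit at infinity, so that Liouville's theorem applies.\<close>

lemma reflected_0_const:
  assumes "reflected 0 p q"
  obtains c where "p = [:c:]" "q = [:cnj c:]"
proof -
  have *: "poly q z = cnj (poly p 0)" if "reflected 0 p q" for p q z
  proof (rule Liouville_weak[where f = "poly q"])
    show "poly q holomorphic_on UNIV" by (intro holomorphic_intros)
    have inv: "((\<lambda>z. 1 / cnj z) \<longlongrightarrow> 0) (at_infinity :: complex filter)"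
    proof -
      have "((\<lambda>z. cnj (inverse z)) \<longlongrightarrow> cnj 0) (at_infinity :: complex filter)"
        by (intro tendsto_cnj tendsto_inverse_0)
      then show ?thesis by (simp add: inverse_eq_divide)
    qed
    have "((\<lambda>z. cnj (poly p (1 / cnj z))) \<longlongrightarrow> cnj (poly p 0)) at_infinity"
      by (intro tendsto_cnj tendsto_poly inv)
    moreover have "\<forall>\<^sub>F z in at_infinity. cnj (poly p (1 / cnj z)) = poly q z"
      using eventually_not_equal_at_infinity[of "0::complex"]
      by eventually_elim (use that in \<open>simp add: reflected_def\<close>)
    ultimately show "(poly q \<longlongrightarrow> cnj (poly p 0)) at_infinity"
      using tendsto_cong by force
  qed
  have "q = [:cnj (poly p 0):]" "p = [:cnj (poly q 0):]"
    using *[OF assms] *[OF reflected_sym[OF assms]] by (auto intro!: poly_eqI simp: poly_eq_poly_eq_iff[symmetric])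
  then show ?thesis using that[of "poly p 0"] by (metis complex_cnj_cnj poly_pCons poly_0 mult_zero_left add_0_right mult_zero_right)
qed

lemma blaschke_0_norm:
  assumes "blaschke 0 f" "z \<in> unit_disc"
  shows "norm (f z) = 1"
proof -
  obtain p q where "reflected 0 p q" and q: "\<forall>z\<in>cball 0 1. poly q z \<noteq> 0"
    and f: "\<forall>z\<in>unit_disc. f z = poly p z / poly q z"
    using assms(1) by (auto simp: blaschke_def)
  then obtain c where c: "p = [:c:]" "q = [:cnj c:]" by (blast elim: reflected_0_const)
  have "poly q 0 \<noteq> 0" using q by simp
  with f assms(2) c show ?thesis by (simp add: norm_divide)
qed

lemma unimodular_const_blaschke_0:
  assumes "norm u = 1" "\<forall>z\<in>unit_disc. f z = u"
  shows "blaschke 0 f"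
proof -
  \<comment> \<open>A square root \<open>v\<close> of \<open>u\<close> satisfies \<open>v / cnj v = v\<^sup>2 = u\<close>.\<close>
  define v where "v = csqrt u"
  have "v\<^sup>2 = u" by (simp add: v_def)
  then have "norm v = 1" using assms(1) by (metis norm_power norm_ge_zero power2_eq_1_iff neg_0_le_iff_le not_one_le_zero)
  then have v: "v \<noteq> 0" "v * cnj v = 1" by (auto simp: complex_norm_square[symmetric])
  then have "u = v / cnj v"
    using \<open>v\<^sup>2 = u\<close> by (metis complex_cnj_zero_iff mult.assoc mult_1_right nonzero_eq_divide_eq power2_eq_square)
  then have "reflected 0 [:v:] [:cnj v:] \<and> (\<forall>z\<in>cball 0 1. poly [:cnj v:] z \<noteq> 0) \<and>
     (\<forall>z\<in>unit_disc. f z = poly [:v:] z / poly [:cnj v:] z)"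
    using assms(2) v by (simp add: reflected_def)
  then show ?thesis unfolding blaschke_def by blast
qed

text \<open>A Blaschke product of positive degree vanishes somewhere in the disc, so it is not a
  unimodular constant.\<close>

lemma blaschke_Suc_norm_less:
  assumes f: "f \<in> H_disc" and "blaschke (Suc k) f" and "z0 \<in> unit_disc"
  shows "norm (f z0) < 1"
proof (rule ccontr)
  assume "\<not> norm (f z0) < 1"
  then have "norm (f z0) = 1" using f assms(3) by (force simp: H_disc_def)
  note const = H_disc_unimodular_value_imp_const[OF f assms(3) this]
  obtain p q where r: "reflected (Suc k) p q" and q: "\<forall>z\<in>cball 0 1. poly q z \<noteq> 0"
    and fpq: "\<forall>z\<in>unit_disc. f z = poly p z / poly q z"
    using assms(2) by (auto simp: blaschke_def)
  \<comment> \<open>A constant \<open>p\<close> would give \<open>q\<close> the form \<open>c * z ^ Suc k\<close>, with a zero at the origin.\<close>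
  have "\<not> constant (poly p)"
  proof
    assume "constant (poly p)"
    then have c: "poly p z = poly p 0" for z unfolding constant_def by metis
    have "poly q 0 = 0 ^ Suc k * cnj (poly p 0)"
    proof (rule continuous_eq_at_excluded_point[where g = "poly q" and h = "\<lambda>z. z ^ Suc k * cnj (poly p 0)"])
      show "\<forall>\<^sub>F z in at 0. poly q z = z ^ Suc k * cnj (poly p 0)"
        using eventually_neq_at_within[of 0 0 UNIV]
        by (rule eventually_mono) (use r c in \<open>metis reflected_def\<close>)
    qed (auto intro!: continuous_intros)
    then show False using q by simp
  qed
  then obtain w where w: "poly p w = 0"
    using Fundamental_Theorem_Algebra.fundamental_theorem_of_algebra by blast
  have "norm w < 1"
  proof (rule ccontr)
    \<comment> \<open>Reflection turns a zero \<open>w\<close> of \<open>p\<close> into the zero \<open>1 / cnj w\<close> of \<open>q\<close>.\<close>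
    assume "\<not> norm w < 1"
    then have "w \<noteq> 0" and "1 / cnj w \<in> cball 0 1" by (auto simp: norm_divide divide_le_eq_1)
    moreover have "poly q (1 / cnj w) = 0"
      using r w \<open>w \<noteq> 0\<close> by (simp add: reflected_def)
    ultimately show False using q by blast
  qed
  then have "f w = 0" using fpq w by simp
  with const[of w] \<open>norm w < 1\<close> \<open>norm (f z0) = 1\<close> show False by simp
qed

text \<open>With \<open>a = f z0\<close> and \<open>f = p / q\<close>, the numerator of \<open>hyp_bracket (f z) a\<close> is \<open>p - a q\<close>, which vanishes at
  \<open>z0\<close>. The denominator \<open>q - cnj a p\<close> is its reflection, hence vanishes at \<open>1 / cnj z0\<close>. Division by
  \<open>hyp_bracket z z0\<close> cancels both linear factors, and the quotients are
  reflections of each other in degree \<open>k\<close>.\<close>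

lemma blaschke_hyp_diff:
  assumes f: "f \<in> H_disc" and b: "blaschke (Suc k) f" and z0: "z0 \<in> unit_disc"
  shows "blaschke k (hyp_diff z0 f)"
proof -
  obtain p q where r: "reflected (Suc k) p q" and q: "\<forall>z\<in>cball 0 1. poly q z \<noteq> 0"
    and fpq: "\<forall>z\<in>unit_disc. f z = poly p z / poly q z"
    using b by (auto simp: blaschke_def)
  define a where "a = f z0"
  have a: "norm a < 1" using blaschke_Suc_norm_less[OF f b z0] by (simp add: a_def)
  have z0': "norm z0 < 1" using z0 by simp
  have "poly p z0 = a * poly q z0" using fpq z0 q by (simp add: a_def)
  then have "poly (p - smult a q) z0 = 0" by simp
  then obtain p1 where p1: "p - smult a q = [:-z0, 1:] * p1"
    using poly_eq_0_iff_dvd by (metis dvdE)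
  have rc: "poly (q - smult (cnj a) p) z = z ^ Suc k * cnj (poly (p - smult a q) (1 / cnj z))"
    if "z \<noteq> 0" for z
    using r reflected_sym[OF r] that by (simp add: reflected_def algebra_simps)
  have "[:1, - cnj z0:] dvd q - smult (cnj a) p"
  proof (cases "z0 = 0")
    case False
    then have "poly (q - smult (cnj a) p) (1 / cnj z0) = 0"
      using rc[of "1 / cnj z0"] \<open>poly (p - smult a q) z0 = 0\<close> by simp
    then have "[:- (1 / cnj z0), 1:] dvd q - smult (cnj a) p"
      using poly_eq_0_iff_dvd by blast
    moreover have "[:1, - cnj z0:] = smult (- cnj z0) [:- (1 / cnj z0), 1:]"
      using False by simp
    ultimately show ?thesis using False by (metis complex_cnj_zero_iff neg_equal_0_iff_equal smult_dvd)
  qed (simp add: one_pCons[symmetric])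
  then obtain q1 where q1: "q - smult (cnj a) p = [:1, - cnj z0:] * q1" by (metis dvdE)
  have P: "poly p z - a * poly q z = (z - z0) * poly p1 z" for z
    using arg_cong[OF p1, of "\<lambda>p. poly p z"] by (simp add: algebra_simps)
  have Q: "poly q z - cnj a * poly p z = (1 - cnj z0 * z) * poly q1 z" for z
    using arg_cong[OF q1, of "\<lambda>p. poly p z"] by (simp add: algebra_simps)
  \<comment> \<open>Cancelling the linear factor loses the point \<open>1 / cnj z0\<close>, which is regained by continuity.\<close>
  have off: "poly q1 z = z ^ k * cnj (poly p1 (1 / cnj z))" if "z \<noteq> 0" "1 - cnj z0 * z \<noteq> 0" for z
  proof -
    have "(1 - cnj z0 * z) * poly q1 z = z ^ Suc k * cnj ((1 / cnj z - z0) * poly p1 (1 / cnj z))"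
      using rc[OF that(1)] P[of "1 / cnj z"] Q[of z] by simp
    also have "\<dots> = (1 - cnj z0 * z) * (z ^ k * cnj (poly p1 (1 / cnj z)))"
      using that(1) by (simp add: field_simps)
    finally show ?thesis using that(2) by simp
  qed
  have "poly q1 z = z ^ k * cnj (poly p1 (1 / cnj z))" if "z \<noteq> 0" for z
  proof (rule continuous_eq_at_excluded_point[where g = "poly q1" and h = "\<lambda>z. z ^ k * cnj (poly p1 (1 / cnj z))"])
    have nz: "1 - cnj z0 * w \<noteq> 0" if "w \<noteq> 1 / cnj z0" for w
      using that by (cases "z0 = 0") (auto simp: field_simps)
    have "\<forall>\<^sub>F w in at z. w \<noteq> 0 \<and> w \<noteq> 1 / cnj z0"
      by (intro eventually_conj eventually_neq_at_within)
    then show "\<forall>\<^sub>F w in at z. poly q1 w = w ^ k * cnj (poly p1 (1 / cnj w))"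
      by (rule eventually_mono) (use off nz in blast)
  qed (use that in \<open>auto intro!: continuous_intros isCont_cnj\<close>)
  then have "reflected k p1 q1" by (simp add: reflected_def)
  moreover have "\<forall>z\<in>cball 0 1. poly q1 z \<noteq> 0"
  proof
    fix z :: complex assume z: "z \<in> cball 0 1"
    have "norm (cnj a * poly p z) \<le> norm a * norm (poly q z)"
      using reflected_norm_le[OF r q z] by (simp add: norm_mult mult_left_mono)
    also have "\<dots> < norm (poly q z)" using a q z by simp
    finally show "poly q1 z \<noteq> 0" using Q[of z] by auto
  qed
  moreover have "\<forall>z\<in>unit_disc. hyp_diff z0 f z = poly p1 z / poly q1 z"
  proof
    fix z assume z: "z \<in> unit_disc"
    have *: "hyp_diff z0 f z = poly p1 z / poly q1 z" if "z \<in> unit_disc" "z \<noteq> z0" for z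
    proof -
      have qz: "poly q z \<noteq> 0" using q that by simp
      have fz: "f z = poly p z / poly q z" using fpq that by blast
      have "hyp_diff z0 f z = ((f z - a) / (1 - cnj a * f z)) / ((z - z0) / (1 - cnj z0 * z))"
        using that by (simp add: hyp_diff_def hyp_bracket_def a_def)
      also have "(f z - a) / (1 - cnj a * f z) = (poly p z - a * poly q z) / (poly q z - cnj a * poly p z)"
      proof -
        have "f z - a = (poly p z - a * poly q z) / poly q z"
          and "1 - cnj a * f z = (poly q z - cnj a * poly p z) / poly q z"
          using qz by (simp_all add: fz diff_divide_distrib)
        then show ?thesis using qz by simp
      qed
      also have "\<dots> = ((z - z0) * poly p1 z) / ((1 - cnj z0 * z) * poly q1 z)"
        by (simp only: P Q)
      also have "\<dots> / ((z - z0) / (1 - cnj z0 * z)) = poly p1 z / poly q1 z"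
        using that one_minus_cnj_mult_nonzero[OF z0', of z] by simp
      finally show ?thesis .
    qed
    show "hyp_diff z0 f z = poly p1 z / poly q1 z"
    proof (cases "z = z0")
      case True
      have "hyp_diff z0 f holomorphic_on unit_disc"
        using hyp_diff_mem_H_disc[OF f z0] by (simp add: H_disc_def)
      then have "isCont (hyp_diff z0 f) z0"
        using z0 holomorphic_on_imp_continuous_on continuous_on_eq_continuous_at open_ball by blast
      moreover have "isCont (\<lambda>z. poly p1 z / poly q1 z) z0"
        using z0 \<open>\<forall>z\<in>cball 0 1. poly q1 z \<noteq> 0\<close> by (auto intro!: continuous_intros)
      moreover have "\<forall>\<^sub>F z in at z0. hyp_diff z0 f z = poly p1 z / poly q1 z"
        using eventually_at_in_open[of unit_disc z0] z0 
        by (auto elim!: eventually_mono intro: *)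
      ultimately show ?thesis using True continuous_eq_at_excluded_point[where g = "hyp_diff z0 f" and w = z0] by blast
    qed (use * z in auto)
  qed
  ultimately show ?thesis unfolding blaschke_def by blast
qed

text \<open>Solving \<open>g = hyp_diff z0 f\<close> for \<open>f\<close> gives \<open>f = (a + b g) / (1 + cnj a b g)\<close> with \<open>a = f z0\<close> and
  \<open>b = hyp_bracket z z0\<close>. Clearing denominators exhibits \<open>f\<close> as a quotient of a polynomial and
  its reflection, with one linear factor more than \<open>g\<close>.\<close>

lemma blaschke_of_hyp_diff:
  assumes f: "f \<in> H_disc" and b: "blaschke k (hyp_diff z0 f)" and z0: "z0 \<in> unit_disc"
  shows "blaschke (Suc k) f"
proof -
  obtain p q where r: "reflected k p q" and q: "\<forall>z\<in>cball 0 1. poly q z \<noteq> 0"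
    and gpq: "\<forall>z\<in>unit_disc. hyp_diff z0 f z = poly p z / poly q z"
    using b by (auto simp: blaschke_def)
  define a where "a = f z0"
  have z0': "norm z0 < 1" using z0 by simp
  \<comment> \<open>For a unimodular constant \<open>f\<close> the difference quotient is \<open>0\<close>, which is not a Blaschke product.\<close>
  have "norm a < 1"
  proof (rule ccontr)
    assume "\<not> norm a < 1"
    then have "norm a = 1" using f z0 by (force simp: H_disc_def a_def)
    then have "poly p z = 0" if "z \<in> unit_disc" for z
      using hyp_diff_of_unimodular_value[OF f z0 _ that] gpq that q by (force simp: a_def)
    then have "unit_disc \<subseteq> {z. poly p z = 0}" by blast
    moreover have "infinite unit_disc" using countable_finite uncountable_ball[of 1 "0::complex"] by auto
    ultimately have "p = 0" using poly_roots_finite finite_subset by blast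
    then have "poly q 1 = 0" using r by (simp add: reflected_def)
    then show False using q by simp
  qed
  define P where "P = smult a ([:1, - cnj z0:] * q) + [:-z0, 1:] * p"
  define Q where "Q = [:1, - cnj z0:] * q + smult (cnj a) ([:-z0, 1:] * p)"
  have P: "poly P z = a * (1 - cnj z0 * z) * poly q z + (z - z0) * poly p z" for z
    by (simp add: P_def algebra_simps)
  have Q: "poly Q z = (1 - cnj z0 * z) * poly q z + cnj a * (z - z0) * poly p z" for z
    by (simp add: Q_def algebra_simps)
  have "reflected (Suc k) P Q"
    unfolding reflected_def
  proof (intro allI impI)
    fix z :: complex assume z: "z \<noteq> 0"
    have "z ^ Suc k * cnj (poly P (1 / cnj z)) =
       cnj a * (z * (1 - z0 / z)) * (z ^ k * cnj (poly q (1 / cnj z))) +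
       (z * (1 / z - cnj z0)) * (z ^ k * cnj (poly p (1 / cnj z)))"
      by (simp add: P algebra_simps)
    also have "\<dots> = cnj a * (z * (1 - z0 / z)) * poly p z + (z * (1 / z - cnj z0)) * poly q z"
      using r reflected_sym[OF r] z by (simp add: reflected_def)
    also have "\<dots> = poly Q z" using z by (simp add: Q field_simps)
    finally show "poly Q z = z ^ Suc k * cnj (poly P (1 / cnj z))" by simp
  qed
  moreover have Qnz: "\<forall>z\<in>cball 0 1. poly Q z \<noteq> 0"
  proof
    fix z :: complex assume z: "z \<in> cball 0 1"
    have nz: "1 - cnj z0 * z \<noteq> 0" using one_minus_cnj_mult_nonzero[OF z0'] z by simp
    \<comment> \<open>The disc automorphism \<open>hyp_bracket z z0\<close> has modulus at most \<open>1\<close> on the closed disc.\<close>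
    have "(norm (1 - cnj z0 * z))\<^sup>2 - (norm (z - z0))\<^sup>2 = (1 - (norm z0)\<^sup>2) * (1 - (norm z)\<^sup>2)"
      unfolding cmod_power2 by (simp add: power2_eq_square algebra_simps)
    moreover have "(1 - (norm z0)\<^sup>2) * (1 - (norm z)\<^sup>2) \<ge> 0" using z z0' by (simp add: power_le_one)
    ultimately have "(norm (z - z0))\<^sup>2 \<le> (norm (1 - cnj z0 * z))\<^sup>2" by linarith
    then have "norm (z - z0) \<le> norm (1 - cnj z0 * z)" by (rule power2_le_imp_le) simp
    then have "norm (cnj a * (z - z0) * poly p z) \<le> norm a * (norm (1 - cnj z0 * z) * norm (poly q z))"
      using reflected_norm_le[OF r q z] by (simp add: norm_mult mult.assoc mult_left_mono mult_mono)
    also have "\<dots> < norm ((1 - cnj z0 * z) * poly q z)"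
      using \<open>norm a < 1\<close> nz q z by (simp add: norm_mult)
    finally show "poly Q z \<noteq> 0" unfolding Q by (metis add_eq_0_iff norm_minus_cancel less_irrefl)
  qed
  moreover have "\<forall>z\<in>unit_disc. f z = poly P z / poly Q z"
  proof
    fix z assume z: "z \<in> unit_disc"
    have nz: "1 - cnj z0 * z \<noteq> 0" using one_minus_cnj_mult_nonzero[OF z0'] z by simp
    have "poly Q z \<noteq> 0" "poly q z \<noteq> 0" using Qnz q z by auto
    show "f z = poly P z / poly Q z"
    proof (cases "z = z0")
      case True
      then show ?thesis using \<open>poly q z \<noteq> 0\<close> nz by (simp add: P Q a_def)
    next
      case False
      have nf: "1 - cnj a * f z \<noteq> 0"
        using one_minus_cnj_mult_nonzero[OF \<open>norm a < 1\<close>, of "f z"] f z by (simp add: H_disc_def)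
      have "((f z - a) / (1 - cnj a * f z)) / ((z - z0) / (1 - cnj z0 * z)) = poly p z / poly q z"
        using bspec[OF gpq z] False unfolding hyp_diff_def hyp_bracket_def a_def by simp
      then have "(f z - a) * (1 - cnj z0 * z) * poly q z = poly p z * ((1 - cnj a * f z) * (z - z0))"
        unfolding divide_divide_eq_right times_divide_eq_left divide_divide_eq_left
        using nf nz False \<open>poly q z \<noteq> 0\<close> frac_eq_eq[of "(1 - cnj a * f z) * (z - z0)" "poly q z"]
        by simp
      then have "f z * poly Q z = poly P z" by (simp add: P Q algebra_simps)
      then show ?thesis using \<open>poly Q z \<noteq> 0\<close> by (simp add: field_simps)
    qed
  qed
  ultimately show ?thesis unfolding blaschke_def by blast
qed

text \<open>The degree does not depend on the base points: a unimodular \<open>k\<close>-th iterate at \<open>zs\<close> makes \<open>f\<close> a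
  Blaschke product of degree \<open>k\<close>, and the \<open>k\<close>-th iterate at \<open>zs'\<close> is then a Blaschke product of degree \<open>0\<close>.\<close>

lemma hyp_iter_unimodular_dichotomy:
  assumes f: "f \<in> H_disc" and "\<forall>i<k. zs i \<in> unit_disc" "\<forall>i<k. zs' i \<in> unit_disc"
    and "z \<in> unit_disc" "z' \<in> unit_disc" and "norm (hyp_iter f zs k z) = 1"
  shows "norm (hyp_iter f zs' k z') = 1"
proof -
  have mem: "hyp_iter f zs i \<in> H_disc" "hyp_iter f zs' i \<in> H_disc" if "i \<le> k" for i
    using assms(2,3) that by (auto intro!: hyp_iter_mem_H_disc[OF f])
  have up: "blaschke k f" if "blaschke (k - i) (hyp_iter f zs i)" "i \<le> k" for i
    using that
  proof (induction i)
    case (Suc i)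
    have "blaschke (k - Suc i) (hyp_diff (zs i) (hyp_iter f zs i))"
      using Suc.prems(1) by simp
    then have "blaschke (Suc (k - Suc i)) (hyp_iter f zs i)"
      using mem(1)[of i] assms(2) Suc.prems(2) by (intro blaschke_of_hyp_diff) auto
    moreover have "Suc (k - Suc i) = k - i" using Suc.prems(2) by simp
    ultimately show ?case using Suc.IH Suc.prems(2) by simp
  qed simp
  have down: "blaschke (k - i) (hyp_iter f zs' i)" if "blaschke k f" "i \<le> k" for i
    using that
  proof (induction i)
    case (Suc i)
    have "Suc (k - Suc i) = k - i" using Suc.prems(2) by simp
    then have "blaschke (Suc (k - Suc i)) (hyp_iter f zs' i)" using Suc by simp
    then have "blaschke (k - Suc i) (hyp_diff (zs' i) (hyp_iter f zs' i))"
      using mem(2)[of i] assms(3) Suc.prems(2) by (intro blaschke_hyp_diff) auto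
    then show ?case by simp
  qed simp
  have "blaschke 0 (hyp_iter f zs k)"
    using H_disc_unimodular_value_imp_const[OF hyp_iter_mem_H_disc[OF f assms(2)] assms(4,6)] assms(6)
    by (intro unimodular_const_blaschke_0) auto
  then have "blaschke 0 (hyp_iter f zs' k)" using up[of k] down[of k] by simp
  then show ?thesis using assms(5) by (rule blaschke_0_norm)
qed

section \<open>Separately holomorphic functions\<close>

text \<open>Points are functions on an index type of which only the coordinates in \<open>I\<close> matter, so that
  variables can be added one at a time in inductions. Separate
  holomorphy is the convenient notion, as it only ever calls for functions of one
  variable; joint regularity is recovered from boundedness.\<close>

definition sep_holo :: "'i set \<Rightarrow> ('i \<Rightarrow> complex set) \<Rightarrow> (('i \<Rightarrow> complex) \<Rightarrow> complex) \<Rightarrow> bool" where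
  "sep_holo I S G \<longleftrightarrow> (\<forall>w w'. (\<forall>i\<in>I. w i = w' i) \<longrightarrow> G w = G w') \<and>
     (\<forall>w\<in>Pi I S. \<forall>i\<in>I. (\<lambda>t. G (w(i := t))) holomorphic_on S i)"

text \<open>Cauchy's estimates on the discs of radius \<open>s < R - r\<close> around \<open>z\<close>, with \<open>s\<close> tending to \<open>R - r\<close>.\<close>

lemma deriv_bound_on_smaller_ball:
  assumes f: "f holomorphic_on ball c R" and M: "\<And>z. z \<in> ball c R \<Longrightarrow> norm (f z) \<le> M"
    and "r < R" "z \<in> ball c r"
  shows "norm ((deriv ^^ n) f z) \<le> fact n * M / (R - r) ^ n"
proof -
  have *: "norm ((deriv ^^ n) f z) \<le> fact n * M / s ^ n" if "0 < s" "s < R - r" for s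
  proof (rule Cauchy_inequality)
    have sub: "cball z s \<subseteq> ball c R"
    proof
      fix x assume "x \<in> cball z s"
      then show "x \<in> ball c R" 
        using assms that dist_triangle[of c x z] by auto
    qed
    show "f holomorphic_on ball z s" using f sub holomorphic_on_subset ball_subset_cball by blast
    show "continuous_on (cball z s) f"
      using f sub holomorphic_on_imp_continuous_on continuous_on_subset by blast
    show "norm (f x) \<le> M" if "norm (z - x) = s" for x
      using M sub that by (auto simp: dist_norm)
  qed (use that in auto)
  have "((\<lambda>s. fact n * M / s ^ n) \<longlongrightarrow> fact n * M / (R - r) ^ n) (at_left (R - r))"
    using \<open>r < R\<close> by (intro tendsto_intros) auto
  moreover have "\<forall>\<^sub>F s in at_left (R - r). 0 < s \<and> s < R - r"
    using \<open>r < R\<close> by (auto simp: eventually_at_left_field intro: exI[of _ 0])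
  then have "\<forall>\<^sub>F s in at_left (R - r). norm ((deriv ^^ n) f z) \<le> fact n * M / s ^ n"
    by (rule eventually_mono) (use * in auto)
  ultimately show ?thesis by (intro tendsto_lowerbound) auto
qed

lemma lipschitz_on_smaller_ball:
  assumes f: "f holomorphic_on ball c R" and M: "\<And>z. z \<in> ball c R \<Longrightarrow> norm (f z) \<le> M"
    and "r < R" "x \<in> ball c r" "y \<in> ball c r"
  shows "norm (f x - f y) \<le> M / (R - r) * norm (x - y)"
proof (rule field_differentiable_bound[where S = "ball c r" and f' = "deriv f"])
  fix z assume z: "z \<in> ball c r"
  then have "z \<in> ball c R" using \<open>r < R\<close> by auto
  then show "(f has_field_derivative deriv f z) (at z within ball c r)"
    using holomorphic_derivI[OF f open_ball] by (meson has_field_derivative_at_within)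
  show "norm (deriv f z) \<le> M / (R - r)"
    using deriv_bound_on_smaller_ball[OF f M \<open>r < R\<close> z, of 1] by simp
qed (use assms in auto)

lemma divided_diff_bound:
  assumes f: "f holomorphic_on ball c R" and M: "\<And>z. z \<in> ball c R \<Longrightarrow> norm (f z) \<le> M"
    and "r < R" "x \<in> ball c r" "y \<in> ball c r"
  shows "norm (divided_diff f x y) \<le> M / (R - r)"
proof (cases "x = y")
  case True
  then show ?thesis
    using deriv_bound_on_smaller_ball[OF f M \<open>r < R\<close> assms(4), of 1] by (simp add: divided_diff_def)
next
  case False
  then show ?thesis
    using lipschitz_on_smaller_ball[OF f M \<open>r < R\<close> assms(5,4)]
    by (simp add: divided_diff_def norm_divide divide_le_eq)
qed

text \<open>The derivative in \<open>z\<close> is a limit of difference quotients, each holomorphic in \<open>t\<close>. The limit is uniform in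
  \<open>t\<close>: for fixed \<open>t\<close>, the divided difference is holomorphic in its second point, with a
  bound independent of \<open>t\<close>, and hence Lipschitz with a constant independent of \<open>t\<close>.\<close>

lemma deriv_holomorphic_in_parameter:
  fixes F :: "complex \<Rightarrow> complex \<Rightarrow> complex"
  assumes "open Z" "open T" "z \<in> Z"
    and Fz: "\<And>t. t \<in> T \<Longrightarrow> (\<lambda>z. F z t) holomorphic_on Z"
    and Ft: "\<And>z. z \<in> Z \<Longrightarrow> F z holomorphic_on T"
    and M: "\<And>z t. z \<in> Z \<Longrightarrow> t \<in> T \<Longrightarrow> norm (F z t) \<le> M"
  shows "(\<lambda>t. deriv (\<lambda>z. F z t) z) holomorphic_on T"
proof -
  obtain R where R: "R > 0" "ball z R \<subseteq> Z" using assms(1,3) open_contains_ball by blast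
  \<comment> \<open>The function is bounded on radius \<open>R\<close>, hence its divided differences on radius \<open>3 R / 4\<close>, hence
    these are Lipschitz on radius \<open>R / 2\<close>, which contains all \<open>z + h n\<close>.\<close>
  define h where "h n = complex_of_real (R / 4 / of_nat (Suc n))" for n
  have h: "h n \<noteq> 0" "norm (h n) = R / 4 / of_nat (Suc n)" for n
    unfolding h_def using R by (simp_all only: norm_of_real of_real_eq_0_iff) auto
  have zh: "z + h n \<in> ball z (R / 4 * 2)" for n
  proof -
    have "R / 4 / of_nat (Suc n) \<le> R / 4" using R by (simp add: field_simps)
    then have "norm (h n) < R / 4 * 2" unfolding h(2) using R by linarith
    then show ?thesis by (simp add: dist_norm)
  qed
  define D where "D t = divided_diff (\<lambda>z. F z t) z" for t
  have hol: "(\<lambda>z. F z t) holomorphic_on ball z R" if "t \<in> T" for t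
    using Fz[OF that] R holomorphic_on_subset by blast
  have bd: "norm (F x t) \<le> M" if "x \<in> ball z R" "t \<in> T" for x t using M that R by blast
  have close: "norm (D t (z + h n) - deriv (\<lambda>z. F z t) z) \<le> (M / (R - R / 4 * 3)) / (R / 4 * 3 - R / 4 * 2) * norm (h n)"
    if "t \<in> T" for t n
  proof -
    have "D t z = deriv (\<lambda>z. F z t) z" by (simp add: D_def divided_diff_def)
    moreover have "norm (D t (z + h n) - D t z) \<le> (M / (R - R / 4 * 3)) / (R / 4 * 3 - R / 4 * 2) * norm (z + h n - z)"
    proof (rule lipschitz_on_smaller_ball)
      show "D t holomorphic_on ball z (R / 4 * 3)"
        unfolding D_def using R that
        by (intro divided_diff_holomorphic holomorphic_on_subset[OF hol]) auto
      show "norm (D t x) \<le> M / (R - R / 4 * 3)" if "x \<in> ball z (R / 4 * 3)" for x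
        unfolding D_def using R that \<open>t \<in> T\<close>
        by (intro divided_diff_bound[OF hol bd]) auto
      show "z + h n \<in> ball z (R / 4 * 2)" by (rule zh)
    qed (use R in auto)
    ultimately show ?thesis by simp
  qed
  show ?thesis
  proof (rule holomorphic_uniform_sequence[OF \<open>open T\<close>])
    show "(\<lambda>t. D t (z + h n)) holomorphic_on T" for n
    proof -
      have "z + h n \<in> Z" using zh[of n] R by auto
      then have "(\<lambda>t. (F (z + h n) t - F z t) / h n) holomorphic_on T"
        using h by (intro holomorphic_intros Ft \<open>z \<in> Z\<close>) auto
      then show ?thesis using h by (simp add: D_def divided_diff_def)
    qed
    fix t assume "t \<in> T"
    then obtain d where d: "d > 0" "cball t d \<subseteq> T" using \<open>open T\<close> open_contains_cball by blast
    have "uniform_limit (cball t d) (\<lambda>n t. D t (z + h n)) (\<lambda>t. deriv (\<lambda>z. F z t) z) sequentially"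
    proof (rule uniform_limitI)
      fix e :: real assume "e > 0"
      have "(\<lambda>n. norm (h n)) \<longlonglongrightarrow> 0"
        unfolding h(2) by (intro LIMSEQ_Suc lim_const_over_n)
      then have "(\<lambda>n. (M / (R - R / 4 * 3)) / (R / 4 * 3 - R / 4 * 2) * norm (h n)) \<longlonglongrightarrow> 0"
        by (rule tendsto_mult_right_zero)
      then have "\<forall>\<^sub>F n in sequentially. (M / (R - R / 4 * 3)) / (R / 4 * 3 - R / 4 * 2) * norm (h n) < e"
        using \<open>e > 0\<close> by (rule order_tendstoD)
      then show "\<forall>\<^sub>F n in sequentially. \<forall>t\<in>cball t d. dist (D t (z + h n)) (deriv (\<lambda>z. F z t) z) < e"
      proof (rule eventually_mono, intro ballI)
        fix n u assume "(M / (R - R / 4 * 3)) / (R / 4 * 3 - R / 4 * 2) * norm (h n) < e" "u \<in> cball t d"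
        then show "dist (D u (z + h n)) (deriv (\<lambda>z. F z u) z) < e"
          using close[of u n] d unfolding dist_norm by (meson order_le_less_trans subsetD)
      qed
    qed
    with d show "\<exists>d>0. cball t d \<subseteq> T \<and>
        uniform_limit (cball t d) (\<lambda>n t. D t (z + h n)) (\<lambda>t. deriv (\<lambda>z. F z t) z) sequentially"
      by blast
  qed
qed

text \<open>The \<open>n\<close>-th derivative is again bounded, on every smaller disc, so that the case of one derivative can be iterated.\<close>

lemma higher_deriv_holomorphic_in_parameter:
  fixes F :: "complex \<Rightarrow> complex \<Rightarrow> complex"
  assumes "open T" "0 < R"
    and Fz: "\<And>t. t \<in> T \<Longrightarrow> (\<lambda>z. F z t) holomorphic_on ball c R"
    and Ft: "\<And>z. z \<in> ball c R \<Longrightarrow> F z holomorphic_on T"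
    and M: "\<And>z t. z \<in> ball c R \<Longrightarrow> t \<in> T \<Longrightarrow> norm (F z t) \<le> M"
  shows "(\<lambda>t. (deriv ^^ n) (\<lambda>z. F z t) c) holomorphic_on T"
proof -
  have "\<forall>z\<in>ball c R. (\<lambda>t. (deriv ^^ n) (\<lambda>z. F z t) z) holomorphic_on T"
  proof (induction n)
    case 0
    then show ?case using Ft by simp
  next
    case (Suc n)
    show ?case
    proof
      fix z assume z: "z \<in> ball c R"
      define r where "r = (dist c z + R) / 2"
      have r: "r < R" "z \<in> ball c r" using z by (auto simp: r_def field_simps)
      have "(\<lambda>t. deriv ((deriv ^^ n) (\<lambda>z. F z t)) z) holomorphic_on T"
      proof (rule deriv_holomorphic_in_parameter[of "ball c r"])
        show "(deriv ^^ n) (\<lambda>z. F z t) holomorphic_on ball c r" if "t \<in> T" for t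
          by (rule holomorphic_on_subset[OF holomorphic_higher_deriv[OF Fz[OF that] open_ball]])
             (use r in \<open>auto intro: subset_ball\<close>)
        show "(\<lambda>t. (deriv ^^ n) (\<lambda>z. F z t) x) holomorphic_on T" if "x \<in> ball c r" for x
          using Suc that r by auto
        show "norm ((deriv ^^ n) (\<lambda>z. F z t) x) \<le> fact n * M / (R - r) ^ n"
          if "x \<in> ball c r" "t \<in> T" for x t
          by (rule deriv_bound_on_smaller_ball[OF Fz M]) (use that r in auto)
      qed (use assms r in auto)
      then show "(\<lambda>t. (deriv ^^ Suc n) (\<lambda>z. F z t) z) holomorphic_on T" by simp
    qed
  qed
  then show ?thesis using \<open>0 < R\<close> by simp
qed

lemma sep_holo_fix_coordinate:
  assumes hol: "sep_holo (insert i I) S G" and "i \<notin> I" "z \<in> S i"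
  shows "sep_holo I S (\<lambda>w. G (w(i := z)))"
  unfolding sep_holo_def
proof (intro conjI allI impI ballI)
  fix w w' :: "'a \<Rightarrow> complex" assume "\<forall>i\<in>I. w i = w' i"
  then show "G (w(i := z)) = G (w'(i := z))" using hol unfolding sep_holo_def by force
next
  fix w j assume w: "w \<in> Pi I S" and j: "j \<in> I"
  have "w(i := z) \<in> Pi (insert i I) S" using w assms(2,3) by (auto simp: Pi_def)
  then have "(\<lambda>t. G (w(i := z, j := t))) holomorphic_on S j"
    using hol j unfolding sep_holo_def by blast
  moreover have "w(i := z, j := t) = w(j := t, i := z)" for t
    using j \<open>i \<notin> I\<close> by (intro fun_upd_twist) auto
  ultimately show "(\<lambda>t. G (w(j := t, i := z))) holomorphic_on S j" by simp
qed

text \<open>Moving from \<open>w\<close> to the centre one coordinate at a time, each step costs at most the Lipschitz bound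
  of one variable.\<close>

lemma sep_holo_lipschitz:
  assumes "finite I" "sep_holo I (\<lambda>i. ball (c i) R) G"
    and "\<And>w. w \<in> (\<Pi> i\<in>I. ball (c i) R) \<Longrightarrow> norm (G w) \<le> M"
    and "r < R" "0 < r" "w \<in> (\<Pi> i\<in>I. ball (c i) r)" "\<And>i. i \<in> I \<Longrightarrow> norm (w i - c i) \<le> s"
  shows "norm (G w - G c) \<le> card I * (M / (R - r) * s)"
  using assms
proof (induction I arbitrary: G w rule: finite_induct)
  case empty
  have "G w = G c" using empty(1) unfolding sep_holo_def by blast
  then show ?case by simp
next
  case (insert i I)
  note hol = insert.prems(1) and bd = insert.prems(2)
  have dep: "G w = G w'" if "\<And>j. j \<in> insert i I \<Longrightarrow> w j = w' j" for w w'
    using hol that unfolding sep_holo_def by blast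
  have sub: "w(i := z) \<in> (\<Pi> i\<in>insert i I. ball (c i) R)"
    if "w \<in> (\<Pi> i\<in>I. ball (c i) R)" "z \<in> ball (c i) R" for w z
    using that by auto
  have "ball (c i) r \<subseteq> ball (c i) R" for i using insert.prems(3) by (intro subset_ball) simp
  then have wR: "w \<in> (\<Pi> i\<in>insert i I. ball (c i) R)" using insert.prems(5) by blast
  have M0: "0 \<le> M" using bd[OF wR] norm_ge_zero order_trans by blast
  have "norm (G (w(i := c i)) - G (c(i := c i))) \<le> card I * (M / (R - r) * s)"
  proof (rule insert.IH[of "\<lambda>w. G (w(i := c i))"])
    show "sep_holo I (\<lambda>i. ball (c i) R) (\<lambda>w. G (w(i := c i)))"
      using hol insert.hyps insert.prems by (intro sep_holo_fix_coordinate) auto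
    show "norm (G (w(i := c i))) \<le> M" if "w \<in> (\<Pi> i\<in>I. ball (c i) R)" for w
      by (rule bd, rule sub[OF that]) (use insert.prems in auto)
  qed (use insert.prems in auto)
  then have 1: "norm (G (w(i := c i)) - G c) \<le> card I * (M / (R - r) * s)" by simp
  have "norm (G (w(i := w i)) - G (w(i := c i))) \<le> M / (R - r) * norm (w i - c i)"
  proof (rule lipschitz_on_smaller_ball[where f = "\<lambda>t. G (w(i := t))" and r = r and c = "c i"])
    show "(\<lambda>t. G (w(i := t))) holomorphic_on ball (c i) R"
      using hol wR unfolding sep_holo_def by blast
    show "norm (G (w(i := z))) \<le> M" if "z \<in> ball (c i) R" for z
      by (rule bd, rule sub) (use that wR in auto)
  qed (use insert.prems in auto)
  also have "\<dots> \<le> M / (R - r) * s"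
    using insert.prems M0 by (intro mult_left_mono) auto
  finally have 2: "norm (G w - G (w(i := c i))) \<le> M / (R - r) * s" by simp
  have "norm (G w - G c) \<le> norm (G w - G (w(i := c i))) + norm (G (w(i := c i)) - G c)"
    by (metis norm_diff_triangle_ineq diff_add_cancel norm_triangle_ineq add_diff_eq)
  also have "\<dots> \<le> card (insert i I) * (M / (R - r) * s)"
  proof -
    have "real (card (insert i I)) = real (card I) + 1" using insert.hyps by simp
    then show ?thesis using 1 2 unfolding \<open>real (card (insert i I)) = _\<close> distrib_right by linarith
  qed
  finally show ?case .
qed

lemma divided_diff_cong_open:
  assumes "open U" "w \<in> U" "z \<in> U" "\<And>x. x \<in> U \<Longrightarrow> f x = g x"
  shows "divided_diff f w z = divided_diff g w z"
proof -
  have "\<forall>\<^sub>F x in nhds w. f x = g x"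
    using assms eventually_nhds_in_open[OF assms(1,2)] by (auto elim: eventually_mono)
  then have "deriv f w = deriv g w" by (intro deriv_cong_ev) auto
  then show ?thesis using assms by (simp add: divided_diff_def)
qed

text \<open>A function of \<open>z\<close> in a disc and of parameters \<open>w\<close>. The variable \<open>z\<close> is kept apart from the others since the
  iterates are evaluated at different values of it within one formula. The independence of
  the coordinates outside \<open>I\<close> is demanded for all \<open>z\<close>, so that it
  survives substitutions without a check that the substituted value lies in the disc.\<close>

definition family_holo ::
  "'i set \<Rightarrow> ('i \<Rightarrow> complex set) \<Rightarrow> real \<Rightarrow> real \<Rightarrow> (complex \<Rightarrow> ('i \<Rightarrow> complex) \<Rightarrow> complex) \<Rightarrow> bool" where
  "family_holo I S R M F \<longleftrightarrow>
     (\<forall>z w w'. (\<forall>i\<in>I. w i = w' i) \<longrightarrow> F z w = F z w') \<and>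
     (\<forall>w\<in>Pi I S. (\<lambda>z. F z w) holomorphic_on ball 0 R) \<and>
     (\<forall>z\<in>ball 0 R. sep_holo I S (F z)) \<and>
     (\<forall>z\<in>ball 0 R. \<forall>w\<in>Pi I S. norm (F z w) \<le> M)"

lemma family_holoD:
  assumes "family_holo I S R M F"
  shows "(\<forall>i\<in>I. w i = w' i) \<Longrightarrow> F z w = F z w'"
    and "w \<in> Pi I S \<Longrightarrow> (\<lambda>z. F z w) holomorphic_on ball 0 R"
    and "z \<in> ball 0 R \<Longrightarrow> sep_holo I S (F z)"
    and "z \<in> ball 0 R \<Longrightarrow> w \<in> Pi I S \<Longrightarrow> norm (F z w) \<le> M"
  using assms unfolding family_holo_def by blast+

lemma sep_holoD:
  assumes "sep_holo I S G"
  shows "(\<forall>i\<in>I. w i = w' i) \<Longrightarrow> G w = G w'"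
    and "w \<in> Pi I S \<Longrightarrow> i \<in> I \<Longrightarrow> (\<lambda>t. G (w(i := t))) holomorphic_on S i"
  using assms unfolding sep_holo_def by blast+

lemma sep_holoI:
  assumes "\<And>w w'. (\<forall>i\<in>I. w i = w' i) \<Longrightarrow> G w = G w'"
    and "\<And>w i. w \<in> Pi I S \<Longrightarrow> i \<in> I \<Longrightarrow> (\<lambda>t. G (w(i := t))) holomorphic_on S i"
  shows "sep_holo I S G"
  using assms unfolding sep_holo_def by simp

lemma sep_holo_const: "sep_holo I S (\<lambda>_. c)"
  by (simp add: sep_holo_def)

lemma sep_holo_diff:
  assumes G: "sep_holo I S G" and H: "sep_holo I S H"
  shows "sep_holo I S (\<lambda>w. G w - H w)"
proof (rule sep_holoI)
  fix w w' :: "'a \<Rightarrow> complex" assume eq: "\<forall>i\<in>I. w i = w' i"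
  show "G w - H w = G w' - H w'" using sep_holoD(1)[OF G eq] sep_holoD(1)[OF H eq] by simp
next
  fix w i assume w: "w \<in> Pi I S" and i: "i \<in> I"
  show "(\<lambda>t. G (w(i := t)) - H (w(i := t))) holomorphic_on S i"
    by (rule holomorphic_on_diff[OF sep_holoD(2)[OF G w i] sep_holoD(2)[OF H w i]])
qed

lemma sep_holo_mult:
  assumes G: "sep_holo I S G" and H: "sep_holo I S H"
  shows "sep_holo I S (\<lambda>w. G w * H w)"
proof (rule sep_holoI)
  fix w w' :: "'a \<Rightarrow> complex" assume eq: "\<forall>i\<in>I. w i = w' i"
  show "G w * H w = G w' * H w'" using sep_holoD(1)[OF G eq] sep_holoD(1)[OF H eq] by simp
next
  fix w i assume w: "w \<in> Pi I S" and i: "i \<in> I"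
  show "(\<lambda>t. G (w(i := t)) * H (w(i := t))) holomorphic_on S i"
    by (rule holomorphic_on_mult[OF sep_holoD(2)[OF G w i] sep_holoD(2)[OF H w i]])
qed

lemma sep_holo_divide:
  assumes G: "sep_holo I S G" and H: "sep_holo I S H" and nz: "\<And>w. w \<in> Pi I S \<Longrightarrow> H w \<noteq> 0"
  shows "sep_holo I S (\<lambda>w. G w / H w)"
proof (rule sep_holoI)
  fix w w' :: "'a \<Rightarrow> complex" assume eq: "\<forall>i\<in>I. w i = w' i"
  show "G w / H w = G w' / H w'" using sep_holoD(1)[OF G eq] sep_holoD(1)[OF H eq] by simp
next
  fix w i assume w: "w \<in> Pi I S" and i: "i \<in> I"
  have "H (w(i := t)) \<noteq> 0" if "t \<in> S i" for t
    using w that by (intro nz) (auto simp: Pi_def)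
  then show "(\<lambda>t. G (w(i := t)) / H (w(i := t))) holomorphic_on S i"
    by (rule holomorphic_on_divide[OF sep_holoD(2)[OF G w i] sep_holoD(2)[OF H w i]])
qed

lemma sep_holo_mono:
  assumes "sep_holo I S G" "\<And>i. i \<in> I \<Longrightarrow> T i \<subseteq> S i"
  shows "sep_holo I T G"
  unfolding sep_holo_def
proof (intro conjI allI impI ballI)
  fix w w' :: "'a \<Rightarrow> complex" assume "\<forall>i\<in>I. w i = w' i"
  then show "G w = G w'" by (intro sep_holoD(1)[OF assms(1)]) blast
next
  fix w i assume "w \<in> Pi I T" "i \<in> I"
  then show "(\<lambda>t. G (w(i := t))) holomorphic_on T i"
    using sep_holoD(2)[OF assms(1), of w i] assms(2) holomorphic_on_subset by blast
qed

lemma family_holo_mono: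
  assumes F: "family_holo I S R M F" and T: "\<And>i. i \<in> I \<Longrightarrow> T i \<subseteq> S i" and "r \<le> R"
  shows "family_holo I T r M F"
  unfolding family_holo_def
proof (intro conjI allI impI ballI)
  have Pi: "w \<in> Pi I S" if "w \<in> Pi I T" for w using that T by (auto simp: Pi_def)
  have ball: "z \<in> ball 0 R" if "z \<in> ball (0::complex) r" for z using that \<open>r \<le> R\<close> by auto
  show "F z w = F z w'" if "\<forall>i\<in>I. w i = w' i" for z w w'
    by (rule family_holoD(1)[OF F that])
  show "(\<lambda>z. F z w) holomorphic_on ball 0 r" if "w \<in> Pi I T" for w
    using family_holoD(2)[OF F Pi[OF that]] ball by (blast intro: holomorphic_on_subset)
  show "sep_holo I T (F z)" if "z \<in> ball 0 r" for z
    by (rule sep_holo_mono[OF family_holoD(3)[OF F ball[OF that]] T])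
  show "norm (F z w) \<le> M" if "z \<in> ball 0 r" "w \<in> Pi I T" for z w
    by (rule family_holoD(4)[OF F ball[OF that(1)] Pi[OF that(2)]])
qed

text \<open>A substitution that uses none of the variables of \<open>H\<close> never needs a chain rule in several variables: each
  single variable enters either through \<open>g\<close> or directly, but not both.\<close>

lemma sep_holo_substitute:
  assumes disj: "I \<inter> J = {}"
    and Hx: "\<And>w. w \<in> Pi I S \<Longrightarrow> (\<lambda>x. H x w) holomorphic_on X"
    and Hw: "\<And>x. x \<in> X \<Longrightarrow> sep_holo I S (H x)"
    and dep: "\<And>x w w'. (\<forall>i\<in>I. w i = w' i) \<Longrightarrow> H x w = H x w'"
    and g: "sep_holo J S g" and gX: "\<And>w. w \<in> Pi J S \<Longrightarrow> g w \<in> X"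
  shows "sep_holo (I \<union> J) S (\<lambda>w. H (g w) w)"
  unfolding sep_holo_def
proof (intro conjI allI impI ballI)
  fix w w' :: "'a \<Rightarrow> complex" assume eq: "\<forall>i\<in>I \<union> J. w i = w' i"
  then have "g w = g w'" by (intro sep_holoD(1)[OF g]) auto
  moreover have "H x w = H x w'" for x using eq by (intro dep) auto
  ultimately show "H (g w) w = H (g w') w'" by simp
next
  fix w i assume w: "w \<in> Pi (I \<union> J) S" and i: "i \<in> I \<union> J"
  have wI: "w \<in> Pi I S" and wJ: "w \<in> Pi J S" using w by auto
  show "(\<lambda>t. H (g (w(i := t))) (w(i := t))) holomorphic_on S i"
  proof (cases "i \<in> I")
    case True
    then have "i \<notin> J" using disj by auto
    then have "g (w(i := t)) = g w" for t by (intro sep_holoD(1)[OF g]) auto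
    then show ?thesis using sep_holoD(2)[OF Hw[OF gX[OF wJ]] wI True] by simp
  next
    case False
    then have "i \<in> J" using i by simp
    have "H x (w(i := t)) = H x w" for x t using False by (intro dep) auto
    moreover have "(\<lambda>t. H (g (w(i := t))) w) holomorphic_on S i"
    proof -
      have "w(i := t) \<in> Pi J S" if "t \<in> S i" for t using wJ that by (auto simp: Pi_def)
      then have "(\<lambda>t. g (w(i := t))) ` S i \<subseteq> X" using gX by blast
      from holomorphic_on_compose_gen[OF sep_holoD(2)[OF g wJ \<open>i \<in> J\<close>] Hx[OF wI] this]
      show ?thesis by (simp add: comp_def)
    qed
    ultimately show ?thesis by simp
  qed
qed

text \<open>Conjugating both the value and the arguments preserves holomorphy. On a conjugation-invariant
  polydisc the resulting function is the extension of \<open>cnj G\<close> from the real points.\<close>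

lemma sep_holo_cnj:
  assumes G: "sep_holo I S G" and S: "\<And>i. i \<in> I \<Longrightarrow> open (S i)" "\<And>i. i \<in> I \<Longrightarrow> cnj ` S i = S i"
  shows "sep_holo I S (\<lambda>w. cnj (G (\<lambda>i. cnj (w i))))"
  unfolding sep_holo_def
proof (intro conjI allI impI ballI)
  fix w w' :: "'a \<Rightarrow> complex" assume eq: "\<forall>i\<in>I. w i = w' i"
  then have "G (\<lambda>i. cnj (w i)) = G (\<lambda>i. cnj (w' i))" by (intro sep_holoD(1)[OF G]) auto
  then show "cnj (G (\<lambda>i. cnj (w i))) = cnj (G (\<lambda>i. cnj (w' i)))" by simp
next
  fix w i assume w: "w \<in> Pi I S" and i: "i \<in> I"
  have "cnj (w i) \<in> S i" if "i \<in> I" for i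
    using w that S(2)[OF that] imageI[of "w i" "S i" cnj] by auto
  then have "(\<lambda>i. cnj (w i)) \<in> Pi I S" by simp
  from sep_holoD(2)[OF G this i]
  have "(\<lambda>t. G ((\<lambda>i. cnj (w i))(i := t))) holomorphic_on cnj ` S i" using S(2)[OF i] by simp
  from holomorphic_on_compose_cnj_cnj[OF this S(1)[OF i]]
  have "(\<lambda>t. cnj (G ((\<lambda>i. cnj (w i))(i := cnj t)))) holomorphic_on S i" by (simp add: comp_def)
  moreover have "(\<lambda>j. cnj ((w(i := t)) j)) = (\<lambda>i. cnj (w i))(i := cnj t)" for t by auto
  ultimately show "(\<lambda>t. cnj (G (\<lambda>j. cnj ((w(i := t)) j)))) holomorphic_on S i" by simp
qed

text \<open>On the diagonal the divided difference is a derivative, and the statement is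
  \<open>deriv_holomorphic_in_parameter\<close>.\<close>

lemma sep_holo_divided_diff:
  assumes F: "family_holo I S R M F" and S: "\<And>i. i \<in> I \<Longrightarrow> open (S i)"
    and x: "x \<in> ball 0 R" and z: "z \<in> ball 0 R"
  shows "sep_holo I S (\<lambda>w. divided_diff (\<lambda>z. F z w) x z)"
  unfolding sep_holo_def
proof (intro conjI allI impI ballI)
  fix w w' :: "'a \<Rightarrow> complex" assume "\<forall>i\<in>I. w i = w' i"
  then have "(\<lambda>z. F z w) = (\<lambda>z. F z w')" using family_holoD(1)[OF F] by blast
  then show "divided_diff (\<lambda>z. F z w) x z = divided_diff (\<lambda>z. F z w') x z" by simp
next
  fix w i assume w: "w \<in> Pi I S" and i: "i \<in> I"
  have wt: "w(i := t) \<in> Pi I S" if "t \<in> S i" for t using w that by (auto simp: Pi_def)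
  note hol = sep_holoD(2)[OF family_holoD(3)[OF F] w i]
  show "(\<lambda>t. divided_diff (\<lambda>z. F z (w(i := t))) x z) holomorphic_on S i"
  proof (cases "z = x")
    case True
    have "(\<lambda>t. deriv (\<lambda>z. F z (w(i := t))) x) holomorphic_on S i"
      by (rule deriv_holomorphic_in_parameter[of "ball 0 R" _ _ _ M])
         (use x S i hol family_holoD(2,4)[OF F] wt in auto)
    then show ?thesis by (simp add: divided_diff_def True)
  next
    case False
    then have "(\<lambda>t. (F z (w(i := t)) - F x (w(i := t))) / (z - x)) holomorphic_on S i"
      by (intro holomorphic_on_divide holomorphic_on_diff hol[OF z] hol[OF x] holomorphic_on_const) auto
    then show ?thesis using False by (simp add: divided_diff_def)
  qed
qed

section \<open>Power series in several variables\<close>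

text \<open>Multi-indices vanish outside \<open>I\<close>, so that each monomial has a unique exponent.\<close>

definition exponents :: "'i set \<Rightarrow> ('i \<Rightarrow> nat) set" where
  "exponents I = {\<alpha>. \<forall>i. i \<notin> I \<longrightarrow> \<alpha> i = 0}"

lemma bij_betw_exponents_insert:
  assumes "i \<notin> I"
  shows "bij_betw (\<lambda>(k, \<alpha>). \<alpha>(i := k)) (UNIV \<times> exponents I) (exponents (insert i I))"
proof (rule bij_betw_byWitness[where f' = "\<lambda>\<alpha>. (\<alpha> i, \<alpha>(i := 0))"])
  show "\<forall>x\<in>UNIV \<times> exponents I. (\<lambda>\<alpha>. (\<alpha> i, \<alpha>(i := 0))) ((\<lambda>(k, \<alpha>). \<alpha>(i := k)) x) = x"
    using assms by (auto simp: exponents_def fun_eq_iff)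
qed (auto simp: exponents_def fun_eq_iff)

lemma prod_exponents_insert:
  fixes x :: "'i \<Rightarrow> 'a :: comm_monoid_mult"
  assumes "i \<notin> I" "finite I"
  shows "(\<Prod>j\<in>insert i I. x j ^ (\<alpha>(i := k)) j) = x i ^ k * (\<Prod>j\<in>I. x j ^ \<alpha> j)"
proof -
  have "(\<Prod>j\<in>I. x j ^ (\<alpha>(i := k)) j) = (\<Prod>j\<in>I. x j ^ \<alpha> j)"
    using assms by (intro prod.cong) auto
  then show ?thesis using assms by simp
qed

lemma summable_multi_geometric:
  fixes x :: "'i \<Rightarrow> real"
  assumes "finite I" "\<And>i. i \<in> I \<Longrightarrow> 0 \<le> x i" "\<And>i. i \<in> I \<Longrightarrow> x i < 1"
  shows "(\<lambda>\<alpha>. \<Prod>i\<in>I. x i ^ \<alpha> i) summable_on exponents I"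
  using assms
proof (induction I rule: finite_induct)
  case empty
  have "exponents {} = {\<lambda>_::'i. 0}" by (auto simp: exponents_def)
  then show ?case by (simp add: summable_on_finite)
next
  case (insert i I)
  have x: "0 \<le> x i" "x i < 1" using insert.prems by auto
  define P where "P \<alpha> = (\<Prod>j\<in>I. x j ^ \<alpha> j)" for \<alpha>
  have P: "(P has_sum infsum P (exponents I)) (exponents I)"
    unfolding P_def using insert by (intro has_sum_infsum insert.IH) auto
  have "summable (\<lambda>k. norm (x i ^ k))" using x by (simp add: summable_geometric)
  then have "(\<lambda>k. x i ^ k) summable_on UNIV" by (rule norm_summable_imp_summable_on)
  then have "(\<lambda>k. x i ^ k * infsum P (exponents I)) summable_on UNIV"
    by (rule summable_on_cmult_left)
  moreover have "0 \<le> P \<alpha>" for \<alpha> using insert.prems by (auto simp: P_def intro!: prod_nonneg)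
  ultimately have "(\<lambda>(k, \<alpha>). x i ^ k * P \<alpha>) summable_on UNIV \<times> exponents I"
    by (intro summable_on_SigmaI[where g = "\<lambda>k. x i ^ k * infsum P (exponents I)"])
       (use x in \<open>auto intro!: has_sum_cmult_right P\<close>)
  also have "(\<lambda>(k, \<alpha>). x i ^ k * P \<alpha>) =
      (\<lambda>y. (\<lambda>\<alpha>. \<Prod>j\<in>insert i I. x j ^ \<alpha> j) ((\<lambda>(k, \<alpha>). \<alpha>(i := k)) y))"
    unfolding P_def using prod_exponents_insert[OF insert.hyps(2,1), of x] by (auto simp: fun_eq_iff)
  finally show ?case
    using summable_on_reindex_bij_betw[OF bij_betw_exponents_insert[OF insert.hyps(2)]] by blast
qed

text \<open>The function is expanded in one variable, and the induction hypothesis is applied to the coefficients,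
  which are higher derivatives and thus separately holomorphic in the remaining variables. Cauchy's
  estimates bound the \<open>k\<close>-th coefficient by \<open>M / r ^ k\<close>. Carrying this bound through the
  induction makes the multiple series absolutely summable, by comparison with a product
  of geometric series, so that the iterated sums combine into one unordered sum.\<close>

lemma sep_holo_power_series:
  assumes "finite I" "sep_holo I (\<lambda>i. ball (c i) R) G"
    and "\<And>w. w \<in> (\<Pi> i\<in>I. ball (c i) R) \<Longrightarrow> norm (G w) \<le> M"
    and "0 < r" "r < R"
  shows "\<exists>b. (\<forall>\<alpha>\<in>exponents I. norm (b \<alpha>) \<le> M / (\<Prod>i\<in>I. r ^ \<alpha> i)) \<and>
    (\<forall>w\<in>\<Pi> i\<in>I. ball (c i) r.
       ((\<lambda>\<alpha>. b \<alpha> * (\<Prod>i\<in>I. (w i - c i) ^ \<alpha> i)) has_sum G w) (exponents I))"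
  using assms(1-3)
proof (induction I arbitrary: G M rule: finite_induct)
  case empty
  have "G w = G c" for w using empty(1) unfolding sep_holo_def by blast
  moreover have "exponents {} = {\<lambda>_::'a. 0}" by (auto simp: exponents_def)
  ultimately show ?case
    using empty(2) by (intro exI[of _ "\<lambda>_. G c"]) (auto intro!: has_sum_finiteI)
next
  case (insert i I)
  note hol = insert.prems(1) and bd = insert.prems(2)
  have sub: "w(i := z) \<in> (\<Pi> i\<in>insert i I. ball (c i) R)"
    if "w \<in> (\<Pi> i\<in>I. ball (c i) R)" "z \<in> ball (c i) R" for w z
    using that by auto
  have R0: "0 < R" using assms by simp
  have hol_i: "(\<lambda>z. G (w(i := z))) holomorphic_on ball (c i) R"
    if "w \<in> (\<Pi> i\<in>I. ball (c i) R)" for w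
  proof -
    have "w(i := c i) \<in> (\<Pi> i\<in>insert i I. ball (c i) R)" using sub that R0 by simp
    then have "(\<lambda>z. G (w(i := c i, i := z))) holomorphic_on ball (c i) R"
      using hol unfolding sep_holo_def by blast
    then show ?thesis by simp
  qed
  define C where "C k w = (deriv ^^ k) (\<lambda>z. G (w(i := z))) (c i) / fact k" for k w
  have C_hol: "sep_holo I (\<lambda>i. ball (c i) R) (C k)" for k
    unfolding sep_holo_def
  proof (intro conjI allI impI ballI)
    fix w w' :: "'a \<Rightarrow> complex" assume "\<forall>i\<in>I. w i = w' i"
    then have "G (w(i := z)) = G (w'(i := z))" for z using hol unfolding sep_holo_def by force
    then show "C k w = C k w'" by (simp add: C_def)
  next
    fix w j assume w: "w \<in> (\<Pi> i\<in>I. ball (c i) R)" and j: "j \<in> I"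
    have wt: "w(j := t) \<in> (\<Pi> i\<in>I. ball (c i) R)" if "t \<in> ball (c j) R" for t
      using w that by auto
    show "(\<lambda>t. C k (w(j := t))) holomorphic_on ball (c j) R"
      unfolding C_def
    proof (intro holomorphic_intros higher_deriv_holomorphic_in_parameter)
      fix z assume z: "z \<in> ball (c i) R"
      show "(\<lambda>t. G (w(j := t, i := z))) holomorphic_on ball (c j) R"
        using sep_holo_fix_coordinate[OF hol insert.hyps(2) z] w j unfolding sep_holo_def by blast
    next
      fix t assume t: "t \<in> ball (c j) R"
      show "(\<lambda>z. G (w(j := t, i := z))) holomorphic_on ball (c i) R" by (rule hol_i[OF wt[OF t]])
      show "norm (G (w(j := t, i := z))) \<le> M" if "z \<in> ball (c i) R" for z
        by (rule bd[OF sub[OF wt[OF t] that]])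
    qed (use R0 in auto)
  qed
  have C_bd: "norm (C k w) \<le> M / r ^ k" if "w \<in> (\<Pi> i\<in>I. ball (c i) R)" for k w
  proof -
    \<comment> \<open>The centre lies in the disc of radius \<open>R - r\<close>, from where the distance to the boundary is \<open>r\<close>.\<close>
    have "norm ((deriv ^^ k) (\<lambda>z. G (w(i := z))) (c i)) \<le> fact k * M / (R - (R - r)) ^ k"
      by (rule deriv_bound_on_smaller_ball[OF hol_i[OF that] bd[OF sub[OF that]]])
         (use assms(4,5) in auto)
    then show ?thesis by (simp add: C_def norm_divide divide_le_eq mult.commute)
  qed
  have "\<forall>k. \<exists>b. (\<forall>\<alpha>\<in>exponents I. norm (b \<alpha>) \<le> M / r ^ k / (\<Prod>i\<in>I. r ^ \<alpha> i)) \<and>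
    (\<forall>w\<in>\<Pi> i\<in>I. ball (c i) r.
       ((\<lambda>\<alpha>. b \<alpha> * (\<Prod>i\<in>I. (w i - c i) ^ \<alpha> i)) has_sum C k w) (exponents I))"
    (is "\<forall>k. \<exists>b. ?P k b")
    using insert.IH[OF C_hol C_bd] by blast
  then obtain b where b: "\<forall>k. ?P k (b k)" by (rule choice[THEN exE])
  have b_bd: "norm (b k \<alpha>) \<le> M / r ^ k / (\<Prod>i\<in>I. r ^ \<alpha> i)" if "\<alpha> \<in> exponents I" for k \<alpha>
    using b that by blast
  have b_sum: "((\<lambda>\<alpha>. b k \<alpha> * (\<Prod>i\<in>I. (w i - c i) ^ \<alpha> i)) has_sum C k w) (exponents I)"
    if "w \<in> (\<Pi> i\<in>I. ball (c i) r)" for k w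
    using b that by blast
  define B where "B \<alpha> = b (\<alpha> i) (\<alpha>(i := 0))" for \<alpha>
  have B_upd: "B (\<alpha>(i := k)) = b k \<alpha>" if "\<alpha> \<in> exponents I" for k \<alpha>
  proof -
    have "\<alpha>(i := 0) = \<alpha>" using that insert.hyps(2) by (auto simp: exponents_def)
    then show ?thesis by (simp add: B_def)
  qed
  note bij = bij_betw_exponents_insert[OF insert.hyps(2)]
  have B_bd: "norm (B \<alpha>) \<le> M / (\<Prod>j\<in>insert i I. r ^ \<alpha> j)" if "\<alpha> \<in> exponents (insert i I)" for \<alpha>
  proof -
    have "\<alpha> \<in> (\<lambda>(k, \<alpha>). \<alpha>(i := k)) ` (UNIV \<times> exponents I)"
      using that by (simp only: bij_betw_imp_surj_on[OF bij])
    then obtain k \<beta> where \<alpha>: "\<alpha> = \<beta>(i := k)" and \<beta>: "\<beta> \<in> exponents I" by auto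
    show ?thesis
      using b_bd[OF \<beta>, of k] prod_exponents_insert[OF insert.hyps(2,1), of "\<lambda>_. r" \<beta> k]
      by (simp only: \<alpha> B_upd[OF \<beta>] divide_divide_eq_left)
  qed
  have "((\<lambda>\<alpha>. B \<alpha> * (\<Prod>i\<in>insert i I. (w i - c i) ^ \<alpha> i)) has_sum G w) (exponents (insert i I))"
    if w: "w \<in> (\<Pi> i\<in>insert i I. ball (c i) r)" for w
  proof -
    have subr: "ball (c j) r \<subseteq> ball (c j) R" for j using assms(5) by (intro subset_ball) simp
    have wI: "w \<in> (\<Pi> i\<in>I. ball (c i) r)" "w \<in> (\<Pi> i\<in>I. ball (c i) R)" "w i \<in> ball (c i) r"
      using w subr by blast+
    define x where "x j = norm (w j - c j) / r" for j
    have x: "0 \<le> x j" "x j < 1" if "j \<in> insert i I" for j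
      using w that assms(4) by (auto simp: x_def dist_norm norm_minus_commute Pi_def)
    define E where "E \<alpha> = B \<alpha> * (\<Prod>i\<in>insert i I. (w i - c i) ^ \<alpha> i)" for \<alpha>
    have "(\<lambda>\<alpha>. norm (E \<alpha>)) summable_on exponents (insert i I)"
    proof (rule Infinite_Sum.abs_summable_on_comparison_test')
      show "(\<lambda>\<alpha>. M * (\<Prod>j\<in>insert i I. x j ^ \<alpha> j)) summable_on exponents (insert i I)"
        using insert.hyps x by (intro summable_on_cmult_right summable_multi_geometric) auto
      fix \<alpha> assume "\<alpha> \<in> exponents (insert i I)"
      then have "norm (E \<alpha>) \<le> M / (\<Prod>j\<in>insert i I. r ^ \<alpha> j) * (\<Prod>j\<in>insert i I. norm (w j - c j) ^ \<alpha> j)"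
        unfolding E_def norm_mult prod_norm[symmetric] norm_power
        by (intro mult_right_mono B_bd prod_nonneg) auto
      also have "\<dots> = M * (\<Prod>j\<in>insert i I. x j ^ \<alpha> j)"
        by (simp only: x_def power_divide prod_dividef times_divide_eq_right times_divide_eq_left)
      finally show "norm (E \<alpha>) \<le> M * (\<Prod>j\<in>insert i I. x j ^ \<alpha> j)" .
    qed
    then have "E summable_on exponents (insert i I)" by (rule abs_summable_summable)
    then have "(\<lambda>y. E ((\<lambda>(k, \<alpha>). \<alpha>(i := k)) y)) summable_on UNIV \<times> exponents I"
      using summable_on_reindex_bij_betw[OF bij, of E] by blast
    moreover have outer: "((\<lambda>k. C k w * (w i - c i) ^ k) has_sum G w) UNIV"
    proof (rule norm_summable_imp_has_sum)
      show "summable (\<lambda>k. norm (C k w * (w i - c i) ^ k))"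
      proof (rule summable_comparison_test')
        show "summable (\<lambda>k. M * x i ^ k)" using x[of i] by (intro summable_mult summable_geometric) auto
        fix k :: nat
        have "norm (C k w * (w i - c i) ^ k) \<le> M / r ^ k * norm (w i - c i) ^ k"
          unfolding norm_mult norm_power by (intro mult_right_mono C_bd wI) auto
        then show "norm (norm (C k w * (w i - c i) ^ k)) \<le> M * x i ^ k"
          by (simp add: x_def power_divide)
      qed
      have "w i \<in> ball (c i) R" using wI subr by blast
      from holomorphic_power_series[OF hol_i[OF wI(2)] this]
      show "(\<lambda>k. C k w * (w i - c i) ^ k) sums G w" by (simp add: C_def)
    qed
    moreover have "((\<lambda>\<alpha>. E (\<alpha>(i := k))) has_sum C k w * (w i - c i) ^ k) (exponents I)" for k
    proof -
      have "((\<lambda>\<alpha>. b k \<alpha> * (\<Prod>i\<in>I. (w i - c i) ^ \<alpha> i) * (w i - c i) ^ k) has_sum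
          C k w * (w i - c i) ^ k) (exponents I)"
        by (intro has_sum_cmult_left b_sum wI)
      then show ?thesis
        by (rule has_sum_cong[THEN iffD1, rotated])
           (simp only: E_def B_upd prod_exponents_insert[OF insert.hyps(2,1), of "\<lambda>j. w j - c j"] ac_simps)
    qed
    ultimately have "((\<lambda>y. E ((\<lambda>(k, \<alpha>). \<alpha>(i := k)) y)) has_sum G w) (UNIV \<times> exponents I)"
      by (intro has_sum_SigmaI) auto
    then have "(E has_sum G w) (exponents (insert i I))"
      using has_sum_reindex_bij_betw[OF bij, of E] by blast
    then show ?thesis unfolding E_def .
  qed
  with B_bd show ?case by blast
qed

section \<open>Complexification of the iterates\<close>

text \<open>The real coordinates of a point of \<open>\<complex>\<^sup>n\<close>, as a point of the complexified space: \<open>(i, False)\<close> is the index of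
  the real part and \<open>(i, True)\<close> that of the imaginary part of \<open>zs i\<close>.\<close>

definition real_coords :: "(nat \<Rightarrow> complex) \<Rightarrow> nat \<times> bool \<Rightarrow> complex" where
  "real_coords zs = (\<lambda>(i, b). complex_of_real (if b then Im (zs i) else Re (zs i)))"

text \<open>The holomorphic functions of the complexified coordinates that extend \<open>zs i\<close> and \<open>cnj (zs i)\<close>.\<close>

definition coord :: "nat \<Rightarrow> (nat \<times> bool \<Rightarrow> complex) \<Rightarrow> complex" where
  "coord i w = w (i, False) + \<i> * w (i, True)"

definition conj_coord :: "nat \<Rightarrow> (nat \<times> bool \<Rightarrow> complex) \<Rightarrow> complex" where
  "conj_coord i w = w (i, False) - \<i> * w (i, True)"

definition real_vars :: "nat \<Rightarrow> (nat \<times> bool) set" where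
  "real_vars n = {..<n} \<times> UNIV"

definition polydisc_around :: "(nat \<Rightarrow> complex) \<Rightarrow> real \<Rightarrow> nat \<times> bool \<Rightarrow> complex set" where
  "polydisc_around a \<epsilon> = (\<lambda>i. ball (real_coords a i) \<epsilon>)"

lemma coord_real_coords [simp]:
  "coord i (real_coords zs) = zs i" "conj_coord i (real_coords zs) = cnj (zs i)"
  by (auto simp: coord_def conj_coord_def real_coords_def complex_eq_iff)

lemma cnj_real_coords [simp]: "(\<lambda>i. cnj (real_coords zs i)) = real_coords zs"
  by (auto simp: real_coords_def)

lemma coord_cnj: "coord i (\<lambda>i. cnj (w i)) = cnj (conj_coord i w)"
  by (simp add: coord_def conj_coord_def)

lemma real_vars_Suc: "real_vars (Suc n) = real_vars n \<union> {(n, False), (n, True)}"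
  by (auto simp: real_vars_def less_Suc_eq UNIV_bool)

lemma finite_real_vars: "finite (real_vars n)"
  by (simp add: real_vars_def)

lemma cnj_polydisc_around: "cnj ` polydisc_around a \<epsilon> i = polydisc_around a \<epsilon> i"
proof -
  have *: "cnj z \<in> polydisc_around a \<epsilon> i" if "z \<in> polydisc_around a \<epsilon> i" for z
  proof -
    have "cnj (real_coords a i) = real_coords a i" using fun_cong[OF cnj_real_coords[of a], of i] by simp
    then have "dist (real_coords a i) (cnj z) = dist (real_coords a i) z"
      using complex_mod_cnj[of "real_coords a i - z"] by (simp add: dist_norm)
    then show ?thesis using that by (simp add: polydisc_around_def)
  qed
  then have "cnj ` polydisc_around a \<epsilon> i \<subseteq> polydisc_around a \<epsilon> i" by blast
  moreover have "z \<in> cnj ` polydisc_around a \<epsilon> i" if "z \<in> polydisc_around a \<epsilon> i" for z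
    using *[OF that] by (metis complex_cnj_cnj imageI)
  ultimately show ?thesis by blast
qed

lemma cnj_Pi_polydisc_around:
  "w \<in> Pi I (polydisc_around a \<epsilon>) \<Longrightarrow> (\<lambda>i. cnj (w i)) \<in> Pi I (polydisc_around a \<epsilon>)"
  unfolding Pi_def using imageI[of _ _ cnj] cnj_polydisc_around by fast

lemma coord_near:
  assumes "w \<in> Pi {(i, False), (i, True)} (polydisc_around a \<epsilon>)"
  shows "norm (coord i w - a i) < 2 * \<epsilon>"
proof -
  have "coord i w - a i = (w (i, False) - real_coords a (i, False)) + \<i> * (w (i, True) - real_coords a (i, True))"
    using coord_real_coords(1)[of i a] unfolding coord_def by (simp add: algebra_simps)
  then have "norm (coord i w - a i) \<le> norm (w (i, False) - real_coords a (i, False)) +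
      norm (\<i> * (w (i, True) - real_coords a (i, True)))"
    using norm_triangle_ineq by metis
  also have "\<dots> < \<epsilon> + \<epsilon>"
    using assms unfolding polydisc_around_def norm_mult
    by (intro add_strict_mono) (auto simp: dist_norm norm_minus_commute)
  finally show ?thesis by simp
qed

lemma sep_holo_coord:
  "sep_holo {(i, False), (i, True)} S (coord i)" "sep_holo {(i, False), (i, True)} S (conj_coord i)"
  unfolding sep_holo_def coord_def conj_coord_def by (auto intro!: holomorphic_intros)

text \<open>The new function is the formula of \<open>hyp_diff_eq\<close> with every conjugate replaced by its holomorphic extension. The new
  base point contributes two fresh variables, which enter only through \<open>coord j\<close>
  and \<open>conj_coord j\<close>. It remains to keep the denominator away from \<open>0\<close>. At the
  centre the two values of \<open>F\<close> in it have moduli below \<open>1\<close> and at most \<open>1\<close>; a Lipschitz bound in the parameters, uniform in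
  \<open>z\<close>, preserves a gap on a small polydisc.\<close>

lemma hyp_diff_family:
  assumes F: "family_holo (real_vars j) (polydisc_around a \<epsilon>0) R M F" and "0 < \<epsilon>0"
    and r: "norm (a j) < r" "r < R" "R < 1"
    and le1: "\<And>z. z \<in> ball 0 R \<Longrightarrow> norm (F z (real_coords a)) \<le> 1"
    and lt1: "norm (F (a j) (real_coords a)) < 1"
  obtains \<epsilon> M' where "0 < \<epsilon>" "\<epsilon> \<le> \<epsilon>0" "norm (a j) + 2 * \<epsilon> < r"
    "family_holo (real_vars (Suc j)) (polydisc_around a \<epsilon>) r M'
      (\<lambda>z w. divided_diff (\<lambda>z. F z w) (coord j w) z * (1 - conj_coord j w * z) /
        (1 - cnj (F (coord j (\<lambda>i. cnj (w i))) (\<lambda>i. cnj (w i))) * F z w))"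
proof -
  let ?I = "real_vars j" and ?J = "{(j, False), (j, True)}" and ?a = "real_coords a"
  have aS: "?a \<in> Pi ?I (polydisc_around a \<epsilon>0)" using \<open>0 < \<epsilon>0\<close> by (simp add: polydisc_around_def)
  have r0: "0 < r" "0 < R" using r norm_ge_zero[of "a j"] by linarith+
  have aj: "a j \<in> ball 0 r" "a j \<in> ball 0 R" using r by auto
  have M0: "0 \<le> M" using family_holoD(4)[OF F aj(2) aS] norm_ge_zero order_trans by blast
  \<comment> \<open>One value has modulus \<open>1 - 4 \<eta>\<close> at the centre and the other at most \<open>1\<close>. If both change by at most
    \<open>\<eta>\<close>, the product has modulus at most \<open>(1 - 3 \<eta>) * (1 + \<eta>) \<le> 1 - 2 \<eta>\<close>.\<close>
  define \<eta> where "\<eta> = (1 - norm (F (a j) ?a)) / 4"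
  have \<eta>: "0 < \<eta>" "\<eta> \<le> 1 / 4" using lt1 by (auto simp: \<eta>_def)
  \<comment> \<open>The change is at most \<open>K * \<epsilon>\<close>: the first term accounts for the base point, which moves by less than \<open>2 \<epsilon>\<close>, the
    second for the parameters, each of which moves by less than \<open>\<epsilon>\<close>.\<close>
  define K where "K = M / (R - r) * 2 + card ?I * (M / (\<epsilon>0 - \<epsilon>0 / 2))"
  have K0: "0 \<le> K" using M0 r \<open>0 < \<epsilon>0\<close> by (auto simp: K_def)
  define \<epsilon> where "\<epsilon> = min (\<epsilon>0 / 2) (min ((r - norm (a j)) / 4) (\<eta> / (K + 1)))"
  have "0 < \<epsilon>" unfolding \<epsilon>_def using \<open>0 < \<epsilon>0\<close> r \<eta> K0 by simp
  moreover have "\<epsilon> \<le> \<epsilon>0 / 2" "\<epsilon> \<le> (r - norm (a j)) / 4"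
    unfolding \<epsilon>_def by linarith+
  ultimately have \<epsilon>: "0 < \<epsilon>" "\<epsilon> \<le> \<epsilon>0 / 2" "4 * \<epsilon> \<le> r - norm (a j)" by auto
  have "\<epsilon> \<le> \<eta> / (K + 1)" unfolding \<epsilon>_def by linarith
  then have "\<epsilon> * (K + 1) \<le> \<eta>" using K0 by (simp add: pos_le_divide_eq)
  then have K\<epsilon>: "K * \<epsilon> \<le> \<eta>" using \<epsilon>(1) by (simp add: algebra_simps)
  have near: "norm (a j) + 2 * \<epsilon> < r" using \<epsilon> by linarith
  let ?S = "polydisc_around a \<epsilon>"
  have S_sub: "?S i \<subseteq> polydisc_around a \<epsilon>0 i" for i
    using \<epsilon> unfolding polydisc_around_def by (intro subset_ball) simp
  have F': "family_holo ?I ?S R M F"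
    using F S_sub by (rule family_holo_mono) simp
  have S_open: "open (?S i)" for i by (simp add: polydisc_around_def)
  have coord_r: "coord j w \<in> ball 0 r" if "w \<in> Pi ?J ?S" for w
    using coord_near[OF that] near norm_triangle_sub[of "coord j w" "a j"] by simp
  have cnj_r: "cnj (conj_coord j w) \<in> ball 0 r" if "w \<in> Pi ?J ?S" for w
    using coord_r[OF cnj_Pi_polydisc_around[OF that]] by (simp add: coord_cnj)
  have r_R: "ball 0 r \<subseteq> ball (0::complex) R" using r by auto

  have F_close: "norm (F z w - F z ?a) \<le> card ?I * (M / (\<epsilon>0 - \<epsilon>0 / 2) * \<epsilon>)"
    if "z \<in> ball 0 R" "w \<in> Pi ?I ?S" for z w
  proof (rule sep_holo_lipschitz[where G = "F z" and c = ?a and R = \<epsilon>0])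
    show "finite ?I" by (rule finite_real_vars)
    show "sep_holo ?I (\<lambda>i. ball (?a i) \<epsilon>0) (F z)"
      using family_holoD(3)[OF F that(1)] by (simp add: polydisc_around_def)
    show "norm (F z w) \<le> M" if "w \<in> (\<Pi> i\<in>?I. ball (?a i) \<epsilon>0)" for w
      by (rule family_holoD(4)[OF F \<open>z \<in> ball 0 R\<close>]) (use that in \<open>simp add: polydisc_around_def\<close>)
    have "?S i \<subseteq> ball (?a i) (\<epsilon>0 / 2)" for i
      using \<epsilon>(2) unfolding polydisc_around_def by (rule subset_ball)
    then show "w \<in> (\<Pi> i\<in>?I. ball (?a i) (\<epsilon>0 / 2))" using that(2) by blast
    show "norm (w i - ?a i) \<le> \<epsilon>" if "i \<in> ?I" for i
    proof -
      have "w i \<in> ?S i" using \<open>w \<in> Pi ?I ?S\<close> that by blast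
      then show ?thesis by (simp add: polydisc_around_def dist_norm norm_minus_commute)
    qed
  qed (use \<open>0 < \<epsilon>0\<close> in auto)
  have K_part: "card ?I * (M / (\<epsilon>0 - \<epsilon>0 / 2) * \<epsilon>) + M / (R - r) * (2 * \<epsilon>) = K * \<epsilon>"
    by (simp add: K_def algebra_simps)
  have Mr: "0 \<le> M / (R - r) * (2 * \<epsilon>)" using M0 r \<epsilon>(1) by simp
  have F_le: "norm (F z w) \<le> 1 + \<eta>" if "z \<in> ball 0 R" "w \<in> Pi ?I ?S" for z w
    using F_close[OF that] le1[OF that(1)] norm_triangle_sub[of "F z w" "F z ?a"] K_part Mr K\<epsilon>
    by linarith
  have F_lt: "norm (F x w) \<le> 1 - 3 * \<eta>" if "x \<in> ball 0 r" "norm (x - a j) \<le> 2 * \<epsilon>" "w \<in> Pi ?I ?S" for x w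
  proof -
    have "norm (F x w - F (a j) w) \<le> M / (R - r) * norm (x - a j)"
      by (rule lipschitz_on_smaller_ball[OF family_holoD(2)[OF F'] family_holoD(4)[OF F']])
         (use that r aj in auto)
    also have "\<dots> \<le> M / (R - r) * (2 * \<epsilon>)"
      using that(2) M0 r by (intro mult_left_mono) auto
    finally have "norm (F x w - F (a j) w) \<le> M / (R - r) * (2 * \<epsilon>)" .
    moreover have "norm (F x w) \<le> norm (F (a j) ?a) + norm (F x w - F (a j) w) + norm (F (a j) w - F (a j) ?a)"
      using norm_triangle_sub[of "F x w" "F (a j) w"] norm_triangle_sub[of "F (a j) w" "F (a j) ?a"]
      by linarith
    moreover have "4 * \<eta> = 1 - norm (F (a j) ?a)" unfolding \<eta>_def by simp
    ultimately show ?thesis using F_close[OF aj(2) that(3)] K_part K\<epsilon> by linarith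
  qed
  let ?Q = "\<lambda>w. cnj (F (coord j (\<lambda>i. cnj (w i))) (\<lambda>i. cnj (w i)))"
  have denom: "2 * \<eta> \<le> norm (1 - ?Q w * F z w)"
    if z: "z \<in> ball 0 R" and w: "w \<in> Pi ?I ?S" "w \<in> Pi ?J ?S" for z w
  proof -
    have "norm (?Q w) \<le> 1 - 3 * \<eta>"
      using coord_near[OF cnj_Pi_polydisc_around[OF w(2)]] coord_r[OF cnj_Pi_polydisc_around[OF w(2)]]
        cnj_Pi_polydisc_around[OF w(1)] F_lt by simp
    then have "norm (?Q w * F z w) \<le> (1 - 3 * \<eta>) * (1 + \<eta>)"
      unfolding norm_mult using F_le[OF z w(1)] \<eta> by (intro mult_mono) auto
    also have "\<dots> \<le> 1 - 2 * \<eta>" using \<eta> by (simp add: algebra_simps)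
    finally show ?thesis using norm_triangle_ineq2[of 1 "?Q w * F z w"] by simp
  qed
  have nz: "1 - ?Q w * F z w \<noteq> 0" if "z \<in> ball 0 R" "w \<in> Pi ?I ?S" "w \<in> Pi ?J ?S" for z w
    using denom[OF that] \<eta>(1) by auto

  define G where "G = (\<lambda>z w. divided_diff (\<lambda>z. F z w) (coord j w) z * (1 - conj_coord j w * z) /
        (1 - ?Q w * F z w))"
  have disj: "?I \<inter> ?J = {}" by (auto simp: real_vars_def)
  have "family_holo (?I \<union> ?J) ?S r (M / (R - r) * 2 / (2 * \<eta>)) G"
    unfolding family_holo_def
  proof (intro conjI allI impI ballI)
    fix z and w w' :: "nat \<times> bool \<Rightarrow> complex" assume eq: "\<forall>i\<in>?I \<union> ?J. w i = w' i"
    have "(\<lambda>z. F z w) = (\<lambda>z. F z w')"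
      using eq family_holoD(1)[OF F'] by (intro ext) blast
    moreover have "F x (\<lambda>i. cnj (w i)) = F x (\<lambda>i. cnj (w' i))" for x
      using eq by (intro family_holoD(1)[OF F']) auto
    moreover have "coord j w = coord j w'" "conj_coord j w = conj_coord j w'"
      using eq by (auto simp: coord_def conj_coord_def)
    ultimately show "G z w = G z w'" unfolding G_def by (simp add: coord_cnj fun_eq_iff)
  next
    fix w assume "w \<in> Pi (?I \<union> ?J) ?S"
    then have w: "w \<in> Pi ?I ?S" "w \<in> Pi ?J ?S" by auto
    have F_hol: "(\<lambda>z. F z w) holomorphic_on ball 0 R" by (rule family_holoD(2)[OF F' w(1)])
    have "divided_diff (\<lambda>z. F z w) (coord j w) holomorphic_on ball 0 R"
      using coord_r[OF w(2)] r_R by (intro divided_diff_holomorphic F_hol) auto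
    then have "(\<lambda>z. G z w) holomorphic_on ball 0 R"
      unfolding G_def using nz[OF _ w] by (intro holomorphic_intros F_hol) auto
    then show "(\<lambda>z. G z w) holomorphic_on ball 0 r" using r_R by (rule holomorphic_on_subset)
  next
    fix z assume "z \<in> ball (0::complex) r"
    then have z: "z \<in> ball 0 R" using r_R by blast
    have "sep_holo (?I \<union> ?J) ?S (\<lambda>w. divided_diff (\<lambda>z. F z w) (coord j w) z)"
    proof (rule sep_holo_substitute[OF disj, where H = "\<lambda>x w. divided_diff (\<lambda>z. F z w) x z"])
      show "(\<lambda>x. divided_diff (\<lambda>z. F z w) x z) holomorphic_on ball 0 R" if "w \<in> Pi ?I ?S" for w
        unfolding divided_diff_commute[of _ _ z]
        by (intro divided_diff_holomorphic family_holoD(2)[OF F' that] z) auto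
      show "sep_holo ?I ?S (\<lambda>w. divided_diff (\<lambda>z. F z w) x z)" if "x \<in> ball 0 R" for x
        by (rule sep_holo_divided_diff[OF F' S_open that z])
      show "divided_diff (\<lambda>z. F z w) x z = divided_diff (\<lambda>z. F z w') x z"
        if "\<forall>i\<in>?I. w i = w' i" for x w w'
        using family_holoD(1)[OF F' that] by simp
      show "coord j w \<in> ball 0 R" if "w \<in> Pi ?J ?S" for w using coord_r[OF that] r_R by blast
    qed (rule sep_holo_coord)
    moreover have "sep_holo (?I \<union> ?J) ?S (\<lambda>w. conj_coord j w)"
      by (rule sep_holo_substitute[OF disj, where H = "\<lambda>x w. x" and X = UNIV])
         (auto intro: sep_holo_coord sep_holo_const)
    moreover have "sep_holo (?I \<union> ?J) ?S (\<lambda>w. F z w)"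
      by (rule sep_holo_substitute[OF disj, where H = "\<lambda>x w. F z w" and X = UNIV and g = "coord j"])
         (auto intro: sep_holo_coord(1) family_holoD(3)[OF F' z] family_holoD(1)[OF F'])
    moreover have "sep_holo (?I \<union> ?J) ?S ?Q"
      unfolding coord_cnj
    proof (rule sep_holo_substitute[OF disj, where H = "\<lambda>x w. cnj (F (cnj x) (\<lambda>i. cnj (w i)))"])
      have cnj_ball: "cnj ` ball 0 R = ball 0 R" by (auto intro!: image_eqI[of _ cnj "cnj _"])
      show "(\<lambda>x. cnj (F (cnj x) (\<lambda>i. cnj (w i)))) holomorphic_on ball 0 R" if "w \<in> Pi ?I ?S" for w
        using holomorphic_on_compose_cnj_cnj[of "\<lambda>x. F x (\<lambda>i. cnj (w i))" "ball 0 R"]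
          family_holoD(2)[OF F' cnj_Pi_polydisc_around[OF that]] cnj_ball by (simp add: comp_def)
      show "sep_holo ?I ?S (\<lambda>w. cnj (F (cnj x) (\<lambda>i. cnj (w i))))" if "x \<in> ball 0 R" for x
        by (rule sep_holo_cnj) (use that family_holoD(3)[OF F'] S_open cnj_polydisc_around in auto)
      show "cnj (F (cnj x) (\<lambda>i. cnj (w i))) = cnj (F (cnj x) (\<lambda>i. cnj (w' i)))"
        if "\<forall>i\<in>?I. w i = w' i" for x w w'
      proof -
        have "F (cnj x) (\<lambda>i. cnj (w i)) = F (cnj x) (\<lambda>i. cnj (w' i))"
          using that by (intro family_holoD(1)[OF F']) auto
        then show ?thesis by simp
      qed
      show "conj_coord j w \<in> ball 0 R" if "w \<in> Pi ?J ?S" for w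
        using cnj_r[OF that] r by simp
    qed (rule sep_holo_coord)
    ultimately show "sep_holo (?I \<union> ?J) ?S (G z)"
      unfolding G_def using nz[OF z]
      by (intro sep_holo_divide sep_holo_mult sep_holo_diff sep_holo_const) auto
  next
    fix z w assume z: "z \<in> ball (0::complex) r" and "w \<in> Pi (?I \<union> ?J) ?S"
    then have w: "w \<in> Pi ?I ?S" "w \<in> Pi ?J ?S" by auto
    have z': "z \<in> ball 0 R" using z r_R by blast
    have 1: "norm (divided_diff (\<lambda>z. F z w) (coord j w) z) \<le> M / (R - r)"
      by (rule divided_diff_bound[OF family_holoD(2)[OF F' w(1)] family_holoD(4)[OF F' _ w(1)]])
         (use r z coord_r[OF w(2)] in auto)
    have "norm (conj_coord j w * z) \<le> 1 * 1"
      unfolding norm_mult using cnj_r[OF w(2)] z r by (intro mult_mono) auto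
    then have 2: "norm (1 - conj_coord j w * z) \<le> 2"
      using norm_triangle_ineq4[of 1 "conj_coord j w * z"] by simp
    show "norm (G z w) \<le> M / (R - r) * 2 / (2 * \<eta>)"
      unfolding G_def norm_divide norm_mult
      by (intro frac_le mult_mono 1 2 denom[OF z' w, unfolded norm_mult])
         (use \<eta> M0 r in auto)
  qed
  then have "family_holo (real_vars (Suc j)) ?S r (M / (R - r) * 2 / (2 * \<eta>)) G"
    by (simp only: real_vars_Suc)
  then show ?thesis using that \<epsilon> near \<open>0 < \<epsilon>0\<close> unfolding G_def by auto
qed

lemma polydisc_margin:
  assumes "a \<in> polydisc n"
  obtains \<epsilon> where "0 < \<epsilon>" "\<And>i. i < n \<Longrightarrow> norm (a i) + 2 * \<epsilon> \<le> 1"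
proof -
  have "\<exists>\<epsilon>>0. \<forall>i<n. norm (a i) + 2 * \<epsilon> \<le> 1"
    using assms
  proof (induction n)
    case 0
    show ?case by (intro exI[of _ 1]) simp
  next
    case (Suc n)
    then obtain \<epsilon> where \<epsilon>: "\<epsilon> > 0" "\<forall>i<n. norm (a i) + 2 * \<epsilon> \<le> 1" by (auto simp: polydisc_def)
    have "norm (a n) < 1" using Suc.prems by (simp add: polydisc_def)
    define e where "e = min \<epsilon> ((1 - norm (a n)) / 2)"
    have e: "0 < e" "e \<le> \<epsilon>" "e \<le> (1 - norm (a n)) / 2"
      unfolding e_def using \<epsilon>(1) \<open>norm (a n) < 1\<close> min.cobounded2 by (simp, simp, fast)
    have "norm (a i) + 2 * e \<le> 1" if "i < Suc n" for i
    proof (cases "i = n")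
      case False
      then have "norm (a i) + 2 * \<epsilon> \<le> 1" using that \<epsilon>(2) by simp
      then show ?thesis using e(2) by linarith
    qed (use e(3) in \<open>simp add: field_simps\<close>)
    then show ?case using e(1) by blast
  qed
  then show ?thesis using that by blast
qed

lemma real_coords_near:
  assumes "real_coords zs \<in> Pi (real_vars n) (polydisc_around a \<epsilon>)" "i < n"
  shows "norm (zs i - a i) < 2 * \<epsilon>"
proof -
  have "real_coords zs \<in> Pi {(i, False), (i, True)} (polydisc_around a \<epsilon>)"
    using assms by (auto simp: real_vars_def)
  from coord_near[OF this] show ?thesis by simp
qed

text \<open>The radius \<open>\<rho>\<close> is general because the step needs the previous function on a disc of larger radius, containing
  the new base point and leaving room for Cauchy's estimates.\<close>

lemma hyp_iter_complexification:
  assumes f: "f \<in> H_disc"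
  shows "a \<in> polydisc j \<Longrightarrow> \<rho> < 1 \<Longrightarrow> \<exists>\<epsilon>>0. \<exists>M F. family_holo (real_vars j) (polydisc_around a \<epsilon>) \<rho> M F \<and>
    (\<forall>zs. real_coords zs \<in> Pi (real_vars j) (polydisc_around a \<epsilon>) \<longrightarrow>
       (\<forall>z\<in>ball 0 \<rho>. F z (real_coords zs) = hyp_iter f zs j z))"
proof (induction j arbitrary: \<rho>)
  case 0
  have "family_holo (real_vars 0) (polydisc_around a 1) \<rho> 1 (\<lambda>z w. f z)"
    using f 0 by (auto simp: family_holo_def real_vars_def sep_holo_const H_disc_def
        intro: holomorphic_on_subset)
  then show ?case by (intro exI[of _ 1] exI[of _ "1::real"]) force
next
  case (Suc j)
  have aj: "norm (a j) < 1" and a: "a \<in> polydisc j" using Suc.prems by (auto simp: polydisc_def)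
  define r where "r = (1 + max \<rho> (norm (a j))) / 2"
  define R where "R = (1 + r) / 2"
  have r: "\<rho> < r" "norm (a j) < r" "r < R" "R < 1"
    using Suc.prems(2) aj by (auto simp: r_def R_def max_def)
  have mem: "hyp_iter f zs j \<in> H_disc" if "zs \<in> polydisc j" for zs
    using that by (intro hyp_iter_mem_H_disc f) (simp add: polydisc_def)
  show ?case
  proof (cases "norm (hyp_iter f a j (a j)) < 1")
    case False
    \<comment> \<open>The iterate is unimodular at \<open>a\<close>, hence at all base points, and the next one vanishes identically.\<close>
    then have eq1: "norm (hyp_iter f a j (a j)) = 1"
      using mem[OF a] aj by (force simp: H_disc_def)
    obtain \<epsilon> where \<epsilon>: "0 < \<epsilon>" "\<And>i. i < Suc j \<Longrightarrow> norm (a i) + 2 * \<epsilon> \<le> 1"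
      using polydisc_margin[OF Suc.prems(1)] by metis
    have "hyp_iter f zs (Suc j) z = 0"
      if zs: "real_coords zs \<in> Pi (real_vars (Suc j)) (polydisc_around a \<epsilon>)" and z: "z \<in> ball 0 \<rho>" for zs z
    proof -
      have zs1: "norm (zs i) < 1" if "i < Suc j" for i
        using real_coords_near[OF zs that] \<epsilon>(2)[OF that] norm_triangle_sub[of "zs i" "a i"] by linarith
      have "norm (hyp_iter f zs j (zs j)) = 1"
        by (rule hyp_iter_unimodular_dichotomy[OF f _ _ _ _ eq1])
           (use a aj zs1 in \<open>auto simp: polydisc_def\<close>)
      then show ?thesis
        using hyp_diff_of_unimodular_value[OF mem[of zs], of "zs j" z] zs1 z Suc.prems(2)
        by (simp add: polydisc_def)
    qed
    moreover have "family_holo (real_vars (Suc j)) (polydisc_around a \<epsilon>) \<rho> 0 (\<lambda>z w. 0)"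
      by (simp add: family_holo_def sep_holo_const)
    ultimately show ?thesis using \<epsilon>(1) by force
  next
    case True
    obtain \<epsilon>0 M F where \<epsilon>0: "\<epsilon>0 > 0" and F: "family_holo (real_vars j) (polydisc_around a \<epsilon>0) R M F"
      and F_eq: "\<And>zs z. real_coords zs \<in> Pi (real_vars j) (polydisc_around a \<epsilon>0) \<Longrightarrow> z \<in> ball 0 R \<Longrightarrow>
         F z (real_coords zs) = hyp_iter f zs j z"
      using Suc.IH[OF a r(4)] by blast
    have "real_coords a \<in> Pi (real_vars j) (polydisc_around a \<epsilon>0)" using \<epsilon>0 by (simp add: polydisc_around_def)
    note Fa = F_eq[OF this]
    have le1: "norm (F z (real_coords a)) \<le> 1" if "z \<in> ball 0 R" for z
      using Fa[OF that] mem[OF a] that r(4) by (auto simp: H_disc_def)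
    have lt1: "norm (F (a j) (real_coords a)) < 1" using Fa[of "a j"] True r by auto
    define G where "G z w = divided_diff (\<lambda>z. F z w) (coord j w) z * (1 - conj_coord j w * z) /
        (1 - cnj (F (coord j (\<lambda>i. cnj (w i))) (\<lambda>i. cnj (w i))) * F z w)" for z w
    obtain \<epsilon> M' where \<epsilon>: "0 < \<epsilon>" "\<epsilon> \<le> \<epsilon>0" "norm (a j) + 2 * \<epsilon> < r"
      and G: "family_holo (real_vars (Suc j)) (polydisc_around a \<epsilon>) r M' G"
      using hyp_diff_family[OF F \<epsilon>0 r(2-4) le1 lt1] unfolding G_def by blast
    have "G z (real_coords zs) = hyp_iter f zs (Suc j) z"
      if zs: "real_coords zs \<in> Pi (real_vars (Suc j)) (polydisc_around a \<epsilon>)" and z: "z \<in> ball 0 \<rho>" for zs z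
    proof -
      have "polydisc_around a \<epsilon> i \<subseteq> polydisc_around a \<epsilon>0 i" for i
        using \<epsilon>(2) unfolding polydisc_around_def by (rule subset_ball)
      then have "real_coords zs \<in> Pi (real_vars j) (polydisc_around a \<epsilon>0)"
        using zs unfolding real_vars_Suc by blast
      note Fz = F_eq[OF this]
      have "norm (zs j) < R"
        using real_coords_near[OF zs, of j] \<epsilon>(3) norm_triangle_sub[of "zs j" "a j"] r(3) by simp
      then have zj: "zs j \<in> ball 0 R" and zR: "z \<in> ball 0 R" using z r by auto
      have "divided_diff (\<lambda>z. F z (real_coords zs)) (zs j) z = divided_diff (hyp_iter f zs j) (zs j) z"
        by (rule divided_diff_cong_open[OF open_ball zj zR Fz])
      then show ?thesis
        unfolding G_def hyp_iter.simps hyp_diff_eq by (simp add: Fz[OF zj] Fz[OF zR])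
    qed
    moreover have "family_holo (real_vars (Suc j)) (polydisc_around a \<epsilon>) \<rho> M' G"
      by (rule family_holo_mono[OF G]) (use r(1) in auto)
    ultimately show ?thesis using \<epsilon>(1) by blast
  qed
qed

section \<open>Real analyticity\<close>

text \<open>The power series of the extension has one exponent for each pair of a coordinate and a truth
  value; splitting it according to the truth value gives the exponents of the real and
  of the imaginary parts.\<close>

lemma real_analytic_on_if_complexified:
  assumes "\<And>a. a \<in> U \<Longrightarrow> \<exists>\<epsilon>>0. \<exists>M G. sep_holo (real_vars n) (polydisc_around a \<epsilon>) G \<and>
      (\<forall>w\<in>Pi (real_vars n) (polydisc_around a \<epsilon>). norm (G w) \<le> M) \<and>
      (\<forall>zs. real_coords zs \<in> Pi (real_vars n) (polydisc_around a \<epsilon>) \<longrightarrow> G (real_coords zs) = H zs)"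
  shows "real_analytic_on n H U"
  unfolding real_analytic_on_def
proof
  fix a assume "a \<in> U"
  then obtain \<epsilon> M G where \<epsilon>: "\<epsilon> > 0" and G: "sep_holo (real_vars n) (polydisc_around a \<epsilon>) G"
    and M: "\<And>w. w \<in> Pi (real_vars n) (polydisc_around a \<epsilon>) \<Longrightarrow> norm (G w) \<le> M"
    and G_eq: "\<And>zs. real_coords zs \<in> Pi (real_vars n) (polydisc_around a \<epsilon>) \<Longrightarrow> G (real_coords zs) = H zs"
    using assms by metis
  obtain b where b: "\<And>w. w \<in> (\<Pi> i\<in>real_vars n. ball (real_coords a i) (\<epsilon> / 2)) \<Longrightarrow>
       ((\<lambda>\<alpha>. b \<alpha> * (\<Prod>i\<in>real_vars n. (w i - real_coords a i) ^ \<alpha> i)) has_sum G w) (exponents (real_vars n))"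
    using sep_holo_power_series[OF finite_real_vars G[unfolded polydisc_around_def] M[unfolded polydisc_around_def],
      of "\<epsilon> / 2"] \<epsilon> by auto
  define pair :: "(nat \<Rightarrow> nat) \<Rightarrow> (nat \<Rightarrow> nat) \<Rightarrow> nat \<times> bool \<Rightarrow> nat"
    where "pair \<alpha> \<beta> = (\<lambda>(i, b). if b then \<beta> i else \<alpha> i)" for \<alpha> \<beta>
  have "((\<lambda>(\<alpha>, \<beta>). b (pair \<alpha> \<beta>) *
            (\<Prod>i<n. complex_of_real (Re (w i - a i) ^ \<alpha> i * Im (w i - a i) ^ \<beta> i)))
          has_sum H w) (multi_indices n \<times> multi_indices n)"
    if w: "\<forall>i<n. norm (w i - a i) < \<epsilon> / 2" for w
  proof -
    have "real_coords w \<in> (\<Pi> i\<in>real_vars n. ball (real_coords a i) (\<epsilon> / 2))"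
    proof (clarsimp simp: real_vars_def)
      fix i b assume "i < n"
      have "norm (real_coords w (i, b) - real_coords a (i, b)) \<le> norm (w i - a i)"
        using abs_Re_le_cmod[of "w i - a i"] abs_Im_le_cmod[of "w i - a i"]
        by (cases b) (simp_all add: real_coords_def flip: of_real_diff)
      then show "dist (real_coords a (i, b)) (real_coords w (i, b)) * 2 < \<epsilon>"
        using w \<open>i < n\<close> by (fastforce simp: dist_norm norm_minus_commute)
    qed
    note w_near = this
    have "ball (real_coords a i) (\<epsilon> / 2) \<subseteq> polydisc_around a \<epsilon> i" for i
      unfolding polydisc_around_def using \<epsilon> by (intro subset_ball) simp
    then have "G (real_coords w) = H w" using w_near by (intro G_eq) blast
    moreover have "(\<Prod>i\<in>real_vars n. (real_coords w i - real_coords a i) ^ \<gamma> i) =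
        (\<Prod>i<n. complex_of_real (Re (w i - a i) ^ \<gamma> (i, False) * Im (w i - a i) ^ \<gamma> (i, True)))" for \<gamma>
    proof -
      have "(\<Prod>i\<in>real_vars n. (real_coords w i - real_coords a i) ^ \<gamma> i) =
          (\<Prod>i<n. \<Prod>b\<in>UNIV. (real_coords w (i, b) - real_coords a (i, b)) ^ \<gamma> (i, b))"
        unfolding real_vars_def by (subst prod.cartesian_product) (simp add: case_prod_unfold)
      then show ?thesis by (simp add: UNIV_bool real_coords_def)
    qed
    ultimately have "((\<lambda>\<gamma>. b \<gamma> * (\<Prod>i<n. complex_of_real
        (Re (w i - a i) ^ \<gamma> (i, False) * Im (w i - a i) ^ \<gamma> (i, True)))) has_sum H w) (exponents (real_vars n))"
      using b[OF w_near] by simp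
    then show ?thesis
      by (rule has_sum_reindex_bij_witness[where j = "\<lambda>(\<alpha>, \<beta>). pair \<alpha> \<beta>" and
            i = "\<lambda>\<gamma>. (\<lambda>i. \<gamma> (i, False), \<lambda>i. \<gamma> (i, True))", THEN iffD2, rotated -1])
         (auto simp: pair_def exponents_def multi_indices_def real_vars_def fun_eq_iff)
  qed
  then show "\<exists>r>0. \<exists>c. \<forall>w. (\<forall>i<n. norm (w i - a i) < r) \<longrightarrow>
        ((\<lambda>(\<alpha>, \<beta>). c \<alpha> \<beta> *
            (\<Prod>i<n. complex_of_real (Re (w i - a i) ^ \<alpha> i * Im (w i - a i) ^ \<beta> i)))
          has_sum H w) (multi_indices n \<times> multi_indices n)"
    using \<epsilon> by (intro exI[of _ "\<epsilon> / 2"] conjI exI[of _ "\<lambda>\<alpha> \<beta>. b (pair \<alpha> \<beta>)"]) auto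
qed

theorem proposition2p1:
  fixes f :: "complex \<Rightarrow> complex" and j :: nat
  assumes "f \<in> H_disc"
  shows "(\<forall>zs\<in>polydisc j. (\<lambda>z. hyp_iter f zs j z) analytic_on unit_disc) \<and>
         (\<forall>z\<in>unit_disc. real_analytic_on j (\<lambda>zs. hyp_iter f zs j z) (polydisc j))"
proof (intro conjI ballI)
  fix zs assume "zs \<in> polydisc j"
  then have "hyp_iter f zs j \<in> H_disc"
    by (intro hyp_iter_mem_H_disc assms) (simp add: polydisc_def)
  then show "(\<lambda>z. hyp_iter f zs j z) analytic_on unit_disc"
    by (simp add: H_disc_def analytic_on_open)
next
  fix z :: complex assume z: "z \<in> unit_disc"
  define \<rho> where "\<rho> = (1 + norm z) / 2"
  have \<rho>: "\<rho> < 1" "z \<in> ball 0 \<rho>" using z by (auto simp: \<rho>_def)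
  show "real_analytic_on j (\<lambda>zs. hyp_iter f zs j z) (polydisc j)"
  proof (rule real_analytic_on_if_complexified)
    fix a assume "a \<in> polydisc j"
    from hyp_iter_complexification[OF assms this \<rho>(1)] \<rho>(2)
    show "\<exists>\<epsilon>>0. \<exists>M G. sep_holo (real_vars j) (polydisc_around a \<epsilon>) G \<and>
      (\<forall>w\<in>Pi (real_vars j) (polydisc_around a \<epsilon>). norm (G w) \<le> M) \<and>
      (\<forall>zs. real_coords zs \<in> Pi (real_vars j) (polydisc_around a \<epsilon>) \<longrightarrow> G (real_coords zs) = hyp_iter f zs j z)"
      unfolding family_holo_def by meson
  qed
qed
end
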